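(* Let $P$ be a Coxeter polyhedron of finite volume in $\mathbb{H}^n$, let $\Gamma$ be the hyperbolic Coxeter group generated by the reflections in the faces of $P$, and let $\varphi:\Gamma\rightarrow G$ be a homomorphism to a group $G$. For each finite vertex $v$ of $P$ consider the stabiliser $\Gamma_v$ of $v$ in $\Gamma$. For each ideal vertex $v$ of $P$ consider the stabilisers $\Gamma_{v,v'}$, for each vertex $v'$ of the Euclidean polyhedron $P'$ associated to $v$. Then $\ker\varphi$ is torsion-free if and only if each such $\Gamma_v$ ($v$ a finite vertex) and each such $\Gamma_{v,v'}$ ($v$ an ideal vertex, $v'$ a vertex of $P'$) has the same order as its image under $\varphi$ in $G$.
   Context: A polyhedron $P$ in hyperbolic $n$-space $\mathbb{H}^n$ is an intersection of a finite collection of closed half-spaces; its faces are the intersections of $P$ with the bounding hyperplanes. $P$ is a Coxeter polyhedron if every dihedral angle between intersecting faces is an integer submultiple $\pi/n_{ij}$ of $\pi$; then the group $\Gamma\subset \mathrm{Isom}(\mathbb{H}^n)$ generated by the reflections in the faces of $P$ is discrete and is called a hyperbolic Coxeter group. A vertex $v$ of a finite volume polyhedron $P$ is either in $\mathbb{H}^n$ (a finite vertex) or on the boundary of $\mathbb{H}^n$ (an ideal vertex). $\Gamma_v$ denotes the stabiliser of $v$ in $\Gamma$. If $v$ is an ideal vertex, let $\Sigma$ be a horosphere based at $v$, chosen sufficiently close to $v$ that it meets only those faces of $P$ that are incident with $v$. Then $\Sigma$ is isometric to Euclidean space $\mathbb{E}^{n-1}$, and $\Gamma_v$ acts on $\Sigma$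 discretely with fundamental region the Euclidean polyhedron $P'=\Sigma\cap P$. For a vertex $v'$ of $P'$, $\Gamma_{v,v'}$ denotes the stabiliser of $v'$ in $\Gamma_v$. All the groups $\Gamma_v$ ($v$ finite) and $\Gamma_{v,v'}$ ($v$ ideal) are finite. *)

theory Defs
  imports "HOL-Analysis.Analysis" "HOL-Algebra.Group_Action" "HOL-Algebra.Generated_Groups"
begin

text \<open>
  The hyperboloid model of hyperbolic \<open>n\<close>-space, \<open>n = CARD('n)\<close>: the first component of a point
  of \<open>real \<times> real ^ 'n\<close> is the time coordinate, and the Lorentzian form has signature \<open>(n, 1)\<close>.
\<close>

type_synonym 'n mink = "real \<times> (real ^ 'n)"

definition lorentz :: "'n::finite mink \<Rightarrow> 'n mink \<Rightarrow> real" where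
  "lorentz x y = snd x \<bullet> snd y - fst x * fst y"

definition hyp :: "'n::finite mink set" where
  "hyp = {x. lorentz x x = -1 \<and> fst x > 0}"

text \<open>
  A point of the boundary at infinity is a future null ray, represented by its unique vector
  with time coordinate 1.
\<close>

definition ideal_boundary :: "'n::finite mink set" where
  "ideal_boundary = {u. lorentz u u = 0 \<and> fst u = 1}"

text \<open>
  Dividing by the time coordinate gives the projective (Klein) model, a ball in the affine
  hyperplane at time 1 whose bounding sphere is the boundary at infinity.
\<close>

definition klein :: "'n::finite mink \<Rightarrow> 'n mink" where
  "klein x = x /\<^sub>R fst x"

definition points_at_infinity :: "'n::finite mink set \<Rightarrow> 'n mink set" where
  "points_at_infinity S = ideal_boundary \<inter> closure (klein ` S)"

text \<open>
  The hyperboloid is the graph of \<open>t = sqrt (1 + \<bar>x\<bar>\<^sup>2)\<close>.  The metric induced on it has Gram matrix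
  \<open>I - x x\<^sup>T / (1 + \<bar>x\<bar>\<^sup>2)\<close> in the coordinates \<open>x\<close>, of determinant \<open>1 / (1 + \<bar>x\<bar>\<^sup>2)\<close>.
\<close>

definition hyp_volume :: "'n::finite mink set \<Rightarrow> ennreal" where
  "hyp_volume S =
     (\<integral>\<^sup>+ x. indicator S (sqrt (1 + (norm x)\<^sup>2), x) * ennreal (1 / sqrt (1 + (norm x)\<^sup>2)) \<partial>lborel)"

text \<open>
  Isometries of hyperbolic space are given by their (unique) linear extensions to Minkowski
  space, the Lorentz transformations preserving the upper sheet of the hyperboloid.
\<close>

definition hyp_isom :: "('n::finite mink \<Rightarrow> 'n mink) monoid" where
  "hyp_isom =
     \<lparr> carrier = {f. linear f \<and> (\<forall>x y. lorentz (f x) (f y) = lorentz x y) \<and> f ` hyp = hyp},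
       monoid.mult = (\<circ>), one = id \<rparr>"

definition ideal_action :: "('n::finite mink \<Rightarrow> 'n mink) \<Rightarrow> 'n mink \<Rightarrow> 'n mink" where
  "ideal_action g u = klein (g u)"

text \<open>
  Hyperplanes and closed half-spaces are given by outward normals \<open>e\<close> with \<open>lorentz e e = 1\<close>.
\<close>

definition hyp_hyperplane :: "'n::finite mink \<Rightarrow> 'n mink set" where
  "hyp_hyperplane e = {x \<in> hyp. lorentz x e = 0}"

definition hyp_halfspace :: "'n::finite mink \<Rightarrow> 'n mink set" where
  "hyp_halfspace e = {x \<in> hyp. lorentz x e \<le> 0}"

definition hyp_reflection :: "'n::finite mink \<Rightarrow> 'n mink \<Rightarrow> 'n mink" where
  "hyp_reflection e x = x - (2 * lorentz x e) *\<^sub>R e"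

definition hyp_polyhedron :: "'n::finite mink set \<Rightarrow> bool" where
  "hyp_polyhedron P \<longleftrightarrow>
     (\<exists>N. finite N \<and> (\<forall>e\<in>N. lorentz e e = 1) \<and> P = hyp \<inter> (\<Inter>e\<in>N. hyp_halfspace e)) \<and>
     top_of_set hyp interior_of P \<noteq> {}"

definition face :: "'n::finite mink set \<Rightarrow> 'n mink \<Rightarrow> 'n mink set" where
  "face P e = P \<inter> hyp_hyperplane e"

text \<open>
  The outward unit normals of \<open>P\<close>, one for each face.  A face has codimension 1: it is
  \<open>(n - 1)\<close>-dimensional, so its linear span in Minkowski space has dimension \<open>n\<close>.  Half-spaces that
  are redundant in a description of \<open>P\<close> are thereby disregarded.
\<close>

definition walls :: "'n::finite mink set \<Rightarrow> 'n mink set" where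
  "walls P = {e. lorentz e e = 1 \<and> P \<subseteq> hyp_halfspace e \<and> dim (face P e) = CARD('n)}"

text \<open>
  Outward normals of two faces enclosing the angle \<open>\<theta>\<close> inside \<open>P\<close> enclose the angle \<open>\<pi> - \<theta>\<close>.
\<close>

definition dihedral_angle :: "'n::finite mink \<Rightarrow> 'n mink \<Rightarrow> real" where
  "dihedral_angle e f = arccos (- lorentz e f)"

definition coxeter_polyhedron :: "'n::finite mink set \<Rightarrow> bool" where
  "coxeter_polyhedron P \<longleftrightarrow> hyp_polyhedron P \<and>
     (\<forall>e\<in>walls P. \<forall>f\<in>walls P. e \<noteq> f \<and> face P e \<inter> face P f \<noteq> {} \<longrightarrow>
        (\<exists>m::nat. m > 0 \<and> dihedral_angle e f = pi / real m))"

definition coxeter_group :: "'n::finite mink set \<Rightarrow> ('n mink \<Rightarrow> 'n mink) monoid" where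
  "coxeter_group P = hyp_isom\<lparr>carrier := generate hyp_isom (hyp_reflection ` walls P)\<rparr>"

text \<open>
  For \<open>v\<close> in the closure of \<open>P\<close>, finite or ideal, these are the faces incident with \<open>v\<close>.
\<close>

definition walls_at :: "'n::finite mink set \<Rightarrow> 'n mink \<Rightarrow> 'n mink set" where
  "walls_at P v = {e \<in> walls P. lorentz v e = 0}"

text \<open>
  A vertex is a point of the closure of \<open>P\<close> that is the only point, finite or ideal, common to
  (the closures of) the bounding hyperplanes through it.
\<close>

definition vertices :: "'n::finite mink set \<Rightarrow> 'n mink set" where
  "vertices P = {v \<in> P \<union> points_at_infinity P.
     {x \<in> hyp \<union> ideal_boundary. \<forall>e\<in>walls_at P v. lorentz x e = 0} = {v}}"

definition finite_vertices :: "'n::finite mink set \<Rightarrow> 'n mink set" where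
  "finite_vertices P = vertices P \<inter> hyp"

definition ideal_vertices :: "'n::finite mink set \<Rightarrow> 'n mink set" where
  "ideal_vertices P = vertices P \<inter> ideal_boundary"

text \<open>
  The horosphere \<open>lorentz x v = - c\<close> approaches the ideal point \<open>v\<close> as \<open>c\<close> tends to 0.  Sufficiently
  close to \<open>v\<close> means that not only the horosphere but the whole horoball bounded by it meets only
  the faces incident with \<open>v\<close>; otherwise a remote horosphere missing \<open>P\<close> would qualify.
\<close>

definition close_horosphere :: "'n::finite mink set \<Rightarrow> 'n mink \<Rightarrow> 'n mink set \<Rightarrow> bool" where
  "close_horosphere P v S \<longleftrightarrow>
     (\<exists>c>0. S = {x \<in> hyp. lorentz x v = - c} \<and>
        (\<forall>e\<in>walls P. face P e \<inter> {x \<in> hyp. lorentz x v \<ge> - c} \<noteq> {} \<longrightarrow> e \<in> walls_at P v))"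

text \<open>
  The vertices of the Euclidean polyhedron \<open>S \<inter> P\<close>, for a horosphere \<open>S\<close> close to its base
  point; its bounding hyperplanes in \<open>S\<close> are \<open>S \<inter> hyp_hyperplane e\<close>.
\<close>

definition link_vertices :: "'n::finite mink set \<Rightarrow> 'n mink set \<Rightarrow> 'n mink set" where
  "link_vertices P S = {w \<in> S \<inter> P. {x \<in> S. \<forall>e\<in>walls_at P w. lorentz x e = 0} = {w}}"

definition finite_vertex_stabilizer ::
    "'n::finite mink set \<Rightarrow> 'n mink \<Rightarrow> ('n mink \<Rightarrow> 'n mink) set" where
  "finite_vertex_stabilizer P v = stabilizer (coxeter_group P) (\<lambda>g. g) v"

definition ideal_vertex_stabilizer ::
    "'n::finite mink set \<Rightarrow> 'n mink \<Rightarrow> ('n mink \<Rightarrow> 'n mink) set" where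
  "ideal_vertex_stabilizer P v = stabilizer (coxeter_group P) ideal_action v"

definition link_vertex_stabilizer ::
    "'n::finite mink set \<Rightarrow> 'n mink \<Rightarrow> 'n mink \<Rightarrow> ('n mink \<Rightarrow> 'n mink) set" where
  "link_vertex_stabilizer P v w =
     stabilizer ((coxeter_group P)\<lparr>carrier := ideal_vertex_stabilizer P v\<rparr>) (\<lambda>g. g) w"

definition torsion_free :: "('a, 'b) monoid_scheme \<Rightarrow> bool" where
  "torsion_free H \<longleftrightarrow>
     (\<forall>x\<in>carrier H. \<forall>m::nat. m > 0 \<and> x [^]\<^bsub>H\<^esub> m = \<one>\<^bsub>H\<^esub> \<longrightarrow> x = \<one>\<^bsub>H\<^esub>)"

end

theory Submission
  imports Defs
begin

text \<open>
  The faces of \<open>P\<close> satisfy \<open>lorentz e f = - cos (pi / m)\<close> if they meet and \<open>lorentz e f \<le> - 1\<close>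
  otherwise, since orthogonal projection to a face of a non-obtuse polyhedron preserves \<open>P\<close>.  Tits'
  argument on reduced words then shows that distinct copies of \<open>P\<close> under \<open>\<Gamma>\<close> have disjoint
  interiors, and that \<open>\<Gamma>\<^sub>p\<close>, for \<open>p\<close> in \<open>P\<close>, fixes every vector orthogonal to the walls through
  \<open>p\<close>.  The orbit of an interior point is therefore discrete, so stabilisers are finite and the
  copies of \<open>P\<close> cover the hyperbolic space.

  An element of finite order fixes a point, the normalised sum over an orbit, and hence has a
  conjugate fixing some \<open>p\<close> in \<open>P\<close>.  Finite volume forces the polyhedral cone over \<open>P\<close> into the light
  cone, so the walls through \<open>p\<close> can be enlarged step by step to those of a finite vertex, or of an
  ideal vertex together with a vertex of its link; the conjugate lies in that vertex group.  So \<open>\<phi>\<close>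
  has torsion-free kernel if and only if it is injective on these finite groups.
\<close>

text \<open>The work is done in the open future cone rather than on the hyperboloid. The cone is
  convex, and the sign of \<open>lorentz x e\<close> does not change under positive scaling, so
  points move along straight segments of Minkowski space and are put back on the hyperboloid only
  when membership in \<open>P\<close> is at stake.

  The definition of a Coxeter polyhedron constrains only faces that meet. Tits' argument, however,
  needs every pair of walls to behave like a pair of Coxeter generators, of finite or infinite
  order, so the bound for disjoint faces has to be derived from convexity. No presentation of the
  group enters: lengths refer to words in the reflections themselves, and one sign statement about
  \<open>w s\<close> for a wall \<open>s\<close> yields disjoint interiors as well as the
  stabilisers.

  The stabiliser of an ideal vertex can be infinite, and comparing orders would then not express
  injectivity; the vertices of the link single out finite subgroups of it.\<close>

text \<open>Minkowski vectors are pairs; quantifiers over them should not be split into components.\<close>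

declare split_paired_All [simp del] split_paired_Ex [simp del]

subsection \<open>Minkowski space\<close>

lemma lorentz_commute: "lorentz x y = lorentz y x"
  by (simp add: lorentz_def inner_commute mult.commute)

lemma lorentz_linear [simp]:
  "lorentz (x + y) z = lorentz x z + lorentz y z" "lorentz z (x + y) = lorentz z x + lorentz z y"
  "lorentz (x - y) z = lorentz x z - lorentz y z" "lorentz z (x - y) = lorentz z x - lorentz z y"
  "lorentz (- x) z = - lorentz x z" "lorentz z (- x) = - lorentz z x"
  "lorentz (c *\<^sub>R x) z = c * lorentz x z" "lorentz z (c *\<^sub>R x) = c * lorentz z x"
  "lorentz 0 z = 0" "lorentz z 0 = 0"
  by (simp_all add: lorentz_def inner_add_left inner_add_right inner_diff_left inner_diff_right
      algebra_simps)

text \<open>Negating the time coordinate of \<open>y\<close> transfers facts on hyperplanes, finite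
  sums and limits from \<open>inner\<close> to \<open>lorentz\<close>.\<close>

lemma lorentz_inner: "lorentz x y = x \<bullet> (- fst y, snd y)"
  by (cases x) (simp add: lorentz_def)

lemma continuous_lorentz [continuous_intros]:
  "continuous_on S f \<Longrightarrow> continuous_on S g \<Longrightarrow> continuous_on S (\<lambda>x. lorentz (f x) (g x))"
  unfolding lorentz_def by (intro continuous_intros)

lemma lorentz_nondegenerate:
  assumes "\<And>x. lorentz x y = 0" shows "y = 0"
proof -
  have "snd y \<bullet> snd y + fst y * fst y = 0"
    using assms[of "(- fst y, snd y)"] by (simp add: lorentz_def)
  then show ?thesis
    by (metis add.commute add_nonneg_eq_0_iff inner_eq_zero_iff inner_ge_zero mult_eq_0_iff
        prod.collapse zero_le_square zero_prod_def)
qed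

section \<open>The future cone\<close>

definition future :: "'n::finite mink set" where
  "future = {x. norm (snd x) < fst x}"

lemma lorentz_self: "lorentz x x = (norm (snd x))\<^sup>2 - (fst x)\<^sup>2"
  by (simp add: lorentz_def dot_square_norm power2_eq_square)

lemma future_iff: "x \<in> future \<longleftrightarrow> lorentz x x < 0 \<and> fst x > 0"
proof -
  have "norm (snd x) < fst x \<longleftrightarrow> (norm (snd x))\<^sup>2 < (fst x)\<^sup>2" if "fst x > 0"
    using that abs_le_square_iff[of "fst x" "norm (snd x)"] by (simp add: not_le[symmetric])
  moreover have "fst x > 0" if "norm (snd x) < fst x"
    using that norm_ge_zero[of "snd x"] by linarith
  ultimately show ?thesis
    by (auto simp: future_def lorentz_self)
qed

lemma hyp_future: "x \<in> hyp \<longleftrightarrow> x \<in> future \<and> lorentz x x = -1"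
  by (auto simp: hyp_def future_iff)

lemma future_scale: "x \<in> future \<Longrightarrow> c > 0 \<Longrightarrow> c *\<^sub>R x \<in> future"
  by (auto simp: future_def)

lemma future_add_causal:
  "x \<in> future \<Longrightarrow> norm (snd y) \<le> fst y \<Longrightarrow> x + y \<in> future"
  using norm_triangle_ineq[of "snd x" "snd y"] by (auto simp: future_def)

lemma future_add: "x \<in> future \<Longrightarrow> y \<in> future \<Longrightarrow> x + y \<in> future"
  by (rule future_add_causal) (simp_all add: future_def)

lemma future_combination:
  assumes "x \<in> future" "y \<in> future" "0 \<le> t" "t \<le> 1"
  shows "(1 - t) *\<^sub>R x + t *\<^sub>R y \<in> future"
proof (cases "t = 0 \<or> t = 1")
  case False
  then show ?thesis using assms by (intro future_add future_scale) auto
qed (use assms in auto)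

lemma future_lorentz_causal:
  assumes x: "x \<in> future" and y: "norm (snd y) \<le> fst y" "y \<noteq> 0"
  shows "lorentz x y < 0"
proof -
  have "fst y > 0"
    using y norm_ge_zero[of "snd y"] by (metis norm_eq_zero order_antisym_conv
        order_less_le order_trans prod_eqI fst_zero snd_zero)
  have "snd x \<bullet> snd y \<le> norm (snd x) * norm (snd y)"
    by (rule norm_cauchy_schwarz)
  also have "\<dots> \<le> norm (snd x) * fst y"
    using y by (simp add: mult_left_mono)
  also have "\<dots> < fst x * fst y"
    using x \<open>fst y > 0\<close> by (simp add: future_def)
  finally show ?thesis by (simp add: lorentz_def)
qed

lemma future_lorentz: "x \<in> future \<Longrightarrow> y \<in> future \<Longrightarrow> lorentz x y < 0"
  by (intro future_lorentz_causal) (auto simp: future_def)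

text \<open>A causal vector or its negative points to the future, where its product with
  \<open>x\<close> cannot vanish. So the orthogonal complement of a timelike vector is
  spacelike.\<close>

lemma future_orthogonal:
  assumes x: "x \<in> future" and y: "lorentz x y = 0" "y \<noteq> 0"
  shows "lorentz y y > 0"
proof (rule ccontr)
  assume "\<not> ?thesis"
  then have "(norm (snd y))\<^sup>2 \<le> \<bar>fst y\<bar>\<^sup>2"
    by (simp add: lorentz_self)
  then have le: "norm (snd y) \<le> \<bar>fst y\<bar>"
    by (rule power2_le_imp_le) simp
  show False
  proof (cases "fst y \<ge> 0")
    case True
    then show ?thesis using future_lorentz_causal[OF x, of y] le y by simp
  next
    case False
    then show ?thesis using future_lorentz_causal[OF x, of "- y"] le y by simp
  qed
qed

text \<open>Timelike vectors form two sheets, and the product with one future causal vector decides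
  between them. A null \<open>v\<close> is allowed, for points on horospheres.\<close>

lemma future_timelike_causal:
  assumes v: "norm (snd v) \<le> fst v" "v \<noteq> 0" and y: "lorentz y y < 0" "lorentz y v < 0"
  shows "y \<in> future"
proof (rule ccontr)
  assume "y \<notin> future"
  then have "fst y \<le> 0" using y by (auto simp: future_iff)
  moreover have "fst y \<noteq> 0" using y(1) by (auto simp: lorentz_self not_less)
  ultimately have "- y \<in> future" using y by (simp add: future_iff)
  from future_lorentz_causal[OF this v] y show False by simp
qed

lemma future_timelike:
  "x \<in> future \<Longrightarrow> lorentz y y < 0 \<Longrightarrow> lorentz x y < 0 \<Longrightarrow> y \<in> future"
  by (rule future_timelike_causal[of x]) (auto simp: future_def lorentz_commute)

lemma future_normalize:
  assumes "x \<in> future"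
  obtains c where "c > 0" "c *\<^sub>R x \<in> hyp"
proof -
  have l: "lorentz x x < 0" using assms by (simp add: future_iff)
  define c where "c = 1 / sqrt (- lorentz x x)"
  have "c > 0" using l by (simp add: c_def)
  moreover have "c * (c * lorentz x x) = -1"
  proof -
    have "(sqrt (- lorentz x x))\<^sup>2 = - lorentz x x" using l by simp
    then show ?thesis using l by (simp add: c_def power2_eq_square field_simps)
  qed
  ultimately show thesis
    using that assms by (simp add: hyp_future future_scale)
qed

lemma open_future: "open future"
  unfolding future_def by (intro open_Collect_less continuous_intros)

section \<open>Small steps and rays in polyhedral cones\<close>

lemma eventually_at_ray:
  fixes x d :: "'n::finite mink"
  assumes "open U" "x \<in> U"
  shows "eventually (\<lambda>s::real. x + s *\<^sub>R d \<in> U) (at_right 0)"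
proof -
  have "((\<lambda>s::real. x + s *\<^sub>R d) \<longlongrightarrow> x + 0 *\<^sub>R d) (at_right 0)"
    by (intro tendsto_intros)
  then show ?thesis using assms by (auto simp: tendsto_def)
qed

text \<open>Finitely many strict inequalities and the cone itself are open conditions. The
  difference of the perturbed point and \<open>x\<close> recovers an arbitrary \<open>d\<close> up
  to scale, which is how faces are shown to span.\<close>

lemma perturb_strict:
  assumes "finite N" "x \<in> future" "\<And>g. g \<in> N \<Longrightarrow> lorentz x g < 0"
  obtains s where "s > 0" "x + s *\<^sub>R d \<in> future" "\<And>g. g \<in> N \<Longrightarrow> lorentz (x + s *\<^sub>R d) g < 0"
proof -
  let ?U = "future \<inter> (\<Inter>g\<in>N. {x. lorentz x g < 0})"
  have "open ?U"
    using assms(1) open_future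
    by (intro open_Int open_INT ballI open_Collect_less) (auto intro!: continuous_intros)
  from eventually_at_ray[OF this, of x d] assms
  have "eventually (\<lambda>s. x + s *\<^sub>R d \<in> ?U \<and> s > 0) (at_right 0)"
    by (intro eventually_conj) (auto simp: eventually_at_right_less)
  then obtain s where "x + s *\<^sub>R d \<in> ?U" "s > 0"
    using eventually_happens trivial_limit_at_right_real by blast
  then show thesis using that by auto
qed

text \<open>The ratio test of linear programming: \<open>s\<close> is the least ratio at which a
  constraint becomes tight. As \<open>lorentz d g > 0\<close>, the \<open>g\<close> found is none of
  the constraints on which \<open>d\<close> vanishes, so the exit produces a new tight wall.\<close>

lemma ray_exit:
  assumes "finite N" and le: "\<And>g. g \<in> N \<Longrightarrow> lorentz x g \<le> 0"
    and h: "h \<in> N" "lorentz d h > 0"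
  obtains s g where "s \<ge> 0" "g \<in> N" "lorentz d g > 0" "lorentz (x + s *\<^sub>R d) g = 0"
    "\<forall>g\<in>N. lorentz (x + s *\<^sub>R d) g \<le> 0"
proof -
  define M where "M = {g \<in> N. lorentz d g > 0}"
  define t where "t g = - lorentz x g / lorentz d g" for g
  have "finite M" "h \<in> M" using assms by (simp_all add: M_def)
  then obtain g where g: "g \<in> M" and mn: "\<And>k. k \<in> M \<Longrightarrow> t g \<le> t k"
    using arg_min_if_finite[of M t] by (metis empty_iff not_less)
  have "t g \<ge> 0" using g le by (auto simp: t_def M_def divide_le_0_iff)
  moreover have "lorentz (x + t g *\<^sub>R d) k \<le> 0" if k: "k \<in> N" for k
  proof (cases "lorentz d k > 0")
    case True
    then have "t g * lorentz d k \<le> t k * lorentz d k"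
      using mn k by (intro mult_right_mono) (auto simp: M_def)
    then show ?thesis using True by (simp add: t_def)
  next
    case False
    then have "t g * lorentz d k \<le> 0" using \<open>t g \<ge> 0\<close> by (simp add: mult_nonneg_nonpos)
    then show ?thesis using le[OF k] by simp
  qed
  moreover have "lorentz (x + t g *\<^sub>R d) g = 0"
    using g by (simp add: t_def M_def)
  ultimately show thesis using that[of "t g" g] g by (simp add: M_def)
qed

lemma lorentz_pos_multiple_iff:
  "c > 0 \<Longrightarrow> lorentz (c *\<^sub>R x) g \<le> 0 \<longleftrightarrow> lorentz x g \<le> 0"
  "c > 0 \<Longrightarrow> lorentz (c *\<^sub>R x) g < 0 \<longleftrightarrow> lorentz x g < 0"
  "c > 0 \<Longrightarrow> lorentz (c *\<^sub>R x) g = 0 \<longleftrightarrow> lorentz x g = 0"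
  by (simp_all add: mult_le_0_iff mult_less_0_iff)

subsection \<open>Reflections\<close>

lemma lorentz_reflection:
  "lorentz e e = 1 \<Longrightarrow> lorentz (hyp_reflection e x) (hyp_reflection e y) = lorentz x y"
  by (simp add: hyp_reflection_def lorentz_commute[of e y] algebra_simps)

lemma reflection_involution:
  "lorentz e e = 1 \<Longrightarrow> hyp_reflection e (hyp_reflection e x) = x"
  by (simp add: hyp_reflection_def algebra_simps)

lemma reflection_self: "lorentz e e = 1 \<Longrightarrow> hyp_reflection e e = - e"
  by (simp add: hyp_reflection_def scaleR_2)

lemma linear_reflection: "linear (hyp_reflection e)"
  by (rule linearI) (simp_all add: hyp_reflection_def algebra_simps)

lemma reflection_future:
  assumes "lorentz e e = 1" "x \<in> future"
  shows "hyp_reflection e x \<in> future"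
proof (rule future_timelike[OF assms(2)])
  show "lorentz (hyp_reflection e x) (hyp_reflection e x) < 0"
    using assms by (simp add: lorentz_reflection future_iff)
  have "lorentz x (hyp_reflection e x) = lorentz x x - 2 * (lorentz x e)\<^sup>2"
    by (simp add: hyp_reflection_def power2_eq_square)
  also have "\<dots> < 0"
    using assms by (smt (verit) future_iff zero_le_power2)
  finally show "lorentz x (hyp_reflection e x) < 0" .
qed

text \<open>The head of the list is the outermost factor. A letter appended at the end acts first,
  so deleting it amounts to composing with that reflection on the right.\<close>

definition word :: "'n::finite mink list \<Rightarrow> 'n mink \<Rightarrow> 'n mink" where
  "word ws = foldr (\<lambda>e f. hyp_reflection e \<circ> f) ws id"

lemma word_simps [simp]: "word [] = id" "word (e # ws) = hyp_reflection e \<circ> word ws"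
  by (simp_all add: word_def)

lemma word_append [simp]: "word (us @ ws) = word us \<circ> word ws"
  by (induction us) (auto simp: o_assoc)

lemma linear_word: "linear (word ws)"
proof (induction ws)
  case Nil
  show ?case unfolding word_simps by (rule linear_id)
next
  case (Cons e ws)
  then show ?case unfolding word_simps by (intro linear_compose linear_reflection)
qed

lemma word_lorentz:
  "(\<And>e. e \<in> set ws \<Longrightarrow> lorentz e e = 1) \<Longrightarrow> lorentz (word ws x) (word ws y) = lorentz x y"
  by (induction ws) (auto simp: lorentz_reflection)

lemma word_future:
  "(\<And>e. e \<in> set ws \<Longrightarrow> lorentz e e = 1) \<Longrightarrow> x \<in> future \<Longrightarrow> word ws x \<in> future"
  by (induction ws) (auto simp: reflection_future)

lemma word_rev:
  "(\<And>e. e \<in> set ws \<Longrightarrow> lorentz e e = 1) \<Longrightarrow> word (rev ws) (word ws x) = x"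
  by (induction ws arbitrary: x) (auto simp: reflection_involution)

lemma word_fix:
  "(\<And>e. e \<in> set ws \<Longrightarrow> lorentz v e = 0) \<Longrightarrow> word ws v = v"
  by (induction ws) (auto simp: hyp_reflection_def)

lemma word_hyp:
  "(\<And>e. e \<in> set ws \<Longrightarrow> lorentz e e = 1) \<Longrightarrow> x \<in> hyp \<Longrightarrow> word ws x \<in> hyp"
  by (simp add: hyp_future word_future word_lorentz)

lemma word_isom:
  assumes "\<And>e. e \<in> set ws \<Longrightarrow> lorentz e e = 1"
  shows "word ws \<in> carrier hyp_isom"
proof -
  have "x \<in> word ws ` hyp" if "x \<in> hyp" for x
    using that word_hyp[of "rev ws" x] word_rev[of "rev ws" x] assms
    by (metis image_eqI rev_rev_ident set_rev)
  then have "word ws ` hyp = hyp" using word_hyp assms by blast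
  then show ?thesis
    using assms by (simp add: hyp_isom_def linear_word word_lorentz)
qed

text \<open>Only inverses need an argument: preserving a nondegenerate form forces injectivity, and
  an injective linear endomap of a finite-dimensional space has a linear inverse.\<close>

lemma group_hyp_isom: "group hyp_isom"
proof (rule groupI)
  fix f :: "'a mink \<Rightarrow> 'a mink" assume "f \<in> carrier hyp_isom"
  then have f: "linear f" "\<And>x y. lorentz (f x) (f y) = lorentz x y" "f ` hyp = hyp"
    by (simp_all add: hyp_isom_def)
  have "x = 0" if "f x = 0" for x
  proof (rule lorentz_nondegenerate)
    show "lorentz y x = 0" for y using f(2)[of y x] that by simp
  qed
  then have inj: "inj f" using f(1) linear_injective_0 by blast
  obtain g where g: "linear g" "\<And>x. f (g x) = x" "\<And>x. g (f x) = x"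
    using linear_injective_isomorphism[OF f(1) inj] by blast
  have "g ` hyp = g ` f ` hyp" using f(3) by simp
  also have "\<dots> = hyp" by (simp only: image_image g image_ident)
  finally have "g \<in> carrier hyp_isom"
    using g f(2)[of "g _" "g _"] by (simp add: hyp_isom_def)
  moreover have "g \<otimes>\<^bsub>hyp_isom\<^esub> f = \<one>\<^bsub>hyp_isom\<^esub>"
    using g by (simp add: hyp_isom_def fun_eq_iff)
  ultimately show "\<exists>y\<in>carrier hyp_isom. y \<otimes>\<^bsub>hyp_isom\<^esub> f = \<one>\<^bsub>hyp_isom\<^esub>"
    by blast
next
  fix f g :: "'a mink \<Rightarrow> 'a mink"
  assume "f \<in> carrier hyp_isom" "g \<in> carrier hyp_isom"
  then show "f \<otimes>\<^bsub>hyp_isom\<^esub> g \<in> carrier hyp_isom"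
    unfolding hyp_isom_def monoid.simps partial_object.simps mem_Collect_eq image_comp [symmetric]
    by (simp add: linear_compose)
next
  show "\<one>\<^bsub>hyp_isom\<^esub> \<in> carrier hyp_isom"
    using linear_id by (simp add: hyp_isom_def id_def)
qed (simp_all add: hyp_isom_def o_assoc)

lemma generate_reflections:
  assumes unit: "\<And>e. e \<in> R \<Longrightarrow> lorentz e e = 1"
  shows "generate hyp_isom (hyp_reflection ` R) = word ` lists R"
proof
  interpret group hyp_isom by (rule group_hyp_isom)
  have word1: "word [e] = hyp_reflection e" for e :: "'a mink"
    unfolding word_simps by simp
  have mult: "f \<otimes>\<^bsub>hyp_isom\<^esub> g = f \<circ> g" and mult_one: "\<one>\<^bsub>hyp_isom\<^esub> = id"
    for f g :: "'a mink \<Rightarrow> 'a mink"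
    by (simp_all add: hyp_isom_def)
  have inv_refl: "inv\<^bsub>hyp_isom\<^esub> (hyp_reflection e) = hyp_reflection e" if "e \<in> R" for e
  proof (rule inv_equality)
    show "hyp_reflection e \<otimes>\<^bsub>hyp_isom\<^esub> hyp_reflection e = \<one>\<^bsub>hyp_isom\<^esub>"
      using unit[OF that] by (simp add: mult mult_one fun_eq_iff reflection_involution)
    show "hyp_reflection e \<in> carrier hyp_isom"
      using word_isom[of "[e]"] unit that unfolding word1 by simp
    then show "hyp_reflection e \<in> carrier hyp_isom" .
  qed
  show "generate hyp_isom (hyp_reflection ` R) \<subseteq> word ` lists R"
  proof
    fix x assume "x \<in> generate hyp_isom (hyp_reflection ` R)"
    then show "x \<in> word ` lists R"
    proof induction
      case one
      have "word [] \<in> word ` lists R" by (intro imageI lists.Nil)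
      then show ?case by (simp only: mult_one word_simps)
    next
      case (incl h)
      then obtain e where "[e] \<in> lists R" "h = word [e]" unfolding word1 by auto
      then show ?case by (rule image_eqI[rotated])
    next
      case (inv h)
      then obtain e where "[e] \<in> lists R" "inv\<^bsub>hyp_isom\<^esub> h = word [e]"
        unfolding word1 using inv_refl by auto
      then show ?case by (rule image_eqI[rotated])
    next
      case (eng h1 h2)
      then obtain us ws where "us \<in> lists R" "ws \<in> lists R" "h1 = word us" "h2 = word ws" by blast
      then have "us @ ws \<in> lists R" "h1 \<otimes>\<^bsub>hyp_isom\<^esub> h2 = word (us @ ws)"
        unfolding mult word_append by simp_all
      then show ?case by (metis image_eqI)
    qed
  qed
  show "word ` lists R \<subseteq> generate hyp_isom (hyp_reflection ` R)"
  proof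
    fix x assume "x \<in> word ` lists R"
    then obtain ws where "ws \<in> lists R" "x = word ws" by blast
    from this(1) have "word ws \<in> generate hyp_isom (hyp_reflection ` R)"
    proof induction
      case Nil
      show ?case using generate.one[of hyp_isom] unfolding mult_one word_simps .
    next
      case (Cons e ws)
      then have "hyp_reflection e \<otimes>\<^bsub>hyp_isom\<^esub> word ws \<in> generate hyp_isom (hyp_reflection ` R)"
        by (intro generate.eng[OF generate.incl]) blast+
      then show ?case unfolding mult word_simps .
    qed
    then show "x \<in> generate hyp_isom (hyp_reflection ` R)" using \<open>x = word ws\<close> by simp
  qed
qed

subsection \<open>Word length and the dihedral case\<close>

text \<open>The generating set is a parameter because lengths with respect to all walls and to a
  pair of walls are compared. For \<open>f\<close> outside the generated group the
  \<open>LEAST\<close> is unspecified, hence the membership premises below.\<close>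

definition word_length :: "'n::finite mink set \<Rightarrow> ('n mink \<Rightarrow> 'n mink) \<Rightarrow> nat" where
  "word_length R f = (LEAST k. \<exists>ws\<in>lists R. length ws = k \<and> word ws = f)"

lemma word_length_le: "ws \<in> lists R \<Longrightarrow> word_length R (word ws) \<le> length ws"
  unfolding word_length_def by (rule Least_le) blast

lemma word_length_attained:
  assumes "f \<in> word ` lists R"
  obtains ws where "ws \<in> lists R" "length ws = word_length R f" "word ws = f"
proof -
  have "\<exists>k. \<exists>ws\<in>lists R. length ws = k \<and> word ws = f" using assms by (metis imageE)
  from LeastI_ex[OF this] show thesis using that unfolding word_length_def by blast
qed

lemma word_length_comp_le:
  assumes "f \<in> word ` lists R" "g \<in> word ` lists R"
  shows "word_length R (f \<circ> g) \<le> word_length R f + word_length R g"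
proof -
  obtain us where us: "us \<in> lists R" "length us = word_length R f" "word us = f"
    using assms(1) by (rule word_length_attained)
  obtain vs where vs: "vs \<in> lists R" "length vs = word_length R g" "word vs = g"
    using assms(2) by (rule word_length_attained)
  have "word_length R (word (us @ vs)) \<le> length (us @ vs)"
    using us vs by (intro word_length_le) auto
  then show ?thesis using us vs by (simp only: word_append length_append)
qed

lemma word_length_mono:
  assumes "f \<in> word ` lists S" "S \<subseteq> R"
  shows "word_length R f \<le> word_length S f"
  using word_length_attained[OF assms(1)] word_length_le lists_mono[OF assms(2)]
  by (metis subsetD)

lemma reflection_word: "e \<in> R \<Longrightarrow> hyp_reflection e \<in> word ` lists R"
proof -
  assume "e \<in> R"
  moreover have "hyp_reflection e = word [e]" unfolding word_simps by simp
  ultimately show ?thesis by (intro image_eqI[of _ _ "[e]"]) auto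
qed

lemma word_comp:
  assumes "f \<in> word ` lists R" "g \<in> word ` lists R"
  shows "f \<circ> g \<in> word ` lists R"
proof -
  obtain us vs where "us \<in> lists R" "word us = f" "vs \<in> lists R" "word vs = g"
    using assms by (metis imageE)
  then have "f \<circ> g = word (us @ vs)" "us @ vs \<in> lists R" by simp_all
  then show ?thesis by (rule image_eqI)
qed

lemma reflection_word_length: "e \<in> R \<Longrightarrow> word_length R (hyp_reflection e) \<le> 1"
  using word_length_le[of "[e]" R] by simp

lemma reflection_comp_self: "lorentz e e = 1 \<Longrightarrow> hyp_reflection e \<circ> hyp_reflection e = id"
  by (simp add: fun_eq_iff reflection_involution)

lemma comp_reflection_cancel:
  "lorentz e e = 1 \<Longrightarrow> f \<circ> hyp_reflection e \<circ> hyp_reflection e = f"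
  by (simp add: comp_assoc reflection_comp_self)

text \<open>The word ends in \<open>t\<close>. Building it from the right with swapped letters keeps
  control of the final letter, the one that acts first.\<close>

fun alternating :: "nat \<Rightarrow> 'a \<Rightarrow> 'a \<Rightarrow> 'a list" where
  "alternating 0 s t = []"
| "alternating (Suc k) s t = alternating k t s @ [t]"

text \<open>For \<open>c = - cos \<theta>\<close> the value at \<open>k\<close> is \<open>sin ((k - 1) * \<theta>) / sin \<theta>\<close>.\<close>

fun sine_ratio :: "real \<Rightarrow> nat \<Rightarrow> real" where
  "sine_ratio c 0 = - 1"
| "sine_ratio c (Suc 0) = 0"
| "sine_ratio c (Suc (Suc k)) = - 2 * c * sine_ratio c (Suc k) - sine_ratio c k"

text \<open>The recurrence is that of the Chebyshev polynomials of the second kind, an addition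
  theorem for the sine. Multiplying by \<open>sin \<theta>\<close> avoids a case distinction on its
  vanishing.\<close>

lemma sine_ratio_cos:
  "sine_ratio (- cos \<theta>) k * sin \<theta> = sin ((real k - 1) * \<theta>)"
proof (induction "- cos \<theta>" k rule: sine_ratio.induct)
  case (3 k)
  have "sin ((real k + 1) * \<theta>) = sin (real k * \<theta> + \<theta>)" "sin ((real k - 1) * \<theta>) = sin (real k * \<theta> - \<theta>)"
    by (simp_all add: algebra_simps)
  then have "sin ((real k + 1) * \<theta>) = 2 * cos \<theta> * sin (real k * \<theta>) - sin ((real k - 1) * \<theta>)"
    by (simp add: sin_add sin_diff)
  with 3 show ?case by (simp add: algebra_simps)
qed simp_all

text \<open>The case of an infinite dihedral group. For consecutive values \<open>p \<le> q\<close>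
  with \<open>q \<ge> 0\<close>, the next one is at least \<open>2 * q - p\<close>, hence at least
  \<open>q\<close>. The index starts at 1, because the value at 0 is \<open>- 1\<close>.\<close>

lemma sine_ratio_le:
  assumes "c \<le> - 1"
  shows "0 \<le> sine_ratio c (Suc k) \<and> sine_ratio c (Suc k) \<le> sine_ratio c (Suc (Suc k))"
proof (induction k)
  case (Suc k)
  let ?p = "sine_ratio c (Suc k)" and ?q = "sine_ratio c (Suc (Suc k))"
  have "2 * ?q \<le> - 2 * c * ?q"
    using Suc assms by (intro mult_right_mono) auto
  then show ?case using Suc by simp
qed simp

text \<open>The last letter sends \<open>t\<close> to \<open>- t\<close> and \<open>s\<close> to
  \<open>s - 2 c t\<close>, after which the remaining word has the roles of the letters exchanged.
  Hence both images are tracked together, and parity tells which root carries which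
  coefficient.\<close>

lemma word_alternating:
  assumes "lorentz s s = 1" "lorentz t t = 1" "lorentz s t = c"
  shows "word (alternating k s t) s =
      (if even k then sine_ratio c (Suc (Suc k)) *\<^sub>R s + sine_ratio c (Suc k) *\<^sub>R t
       else sine_ratio c (Suc k) *\<^sub>R s + sine_ratio c (Suc (Suc k)) *\<^sub>R t) \<and>
    word (alternating k s t) t =
      - (if even k then sine_ratio c (Suc k) *\<^sub>R s + sine_ratio c k *\<^sub>R t
         else sine_ratio c k *\<^sub>R s + sine_ratio c (Suc k) *\<^sub>R t)"
  using assms
proof (induction k arbitrary: s t)
  case (Suc k)
  have ts: "lorentz t s = c" using Suc.prems by (simp add: lorentz_commute)
  have s: "word (alternating (Suc k) s t) s =
      word (alternating k t s) s - (2 * c) *\<^sub>R word (alternating k t s) t"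
    using Suc.prems
    by (simp add: hyp_reflection_def linear_diff[OF linear_word] linear_scale[OF linear_word])
  have t: "word (alternating (Suc k) s t) t = - word (alternating k t s) t"
    using Suc.prems by (simp add: reflection_self linear_neg[OF linear_word])
  show ?case
    unfolding s t using Suc.IH[OF Suc.prems(2,1) ts] by (simp add: algebra_simps)
qed (simp add: algebra_simps)

lemma alternating_lists: "alternating k s t \<in> lists {s, t}"
  by (induction k arbitrary: s t) (auto simp: insert_commute)

lemma length_alternating [simp]: "length (alternating k s t) = k"
  by (induction k arbitrary: s t) auto

lemma alternating_add:
  "\<exists>us \<in> lists {s, t}. length us = j \<and> alternating (j + m) s t = us @ alternating m s t"
proof (induction m arbitrary: s t)
  case 0
  then show ?case using alternating_lists[of j s t] by auto
next
  case (Suc m)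
  from Suc[of t s] show ?case by (auto simp: insert_commute)
qed

lemma alternating_if_distinct_adj:
  assumes "ws \<in> lists {s, t}" "distinct_adj ws" "ws = [] \<or> last ws = t"
  shows "ws = alternating (length ws) s t"
  using assms
proof (induction ws arbitrary: s t rule: rev_induct)
  case (snoc e ws)
  then have "e = t" "ws \<in> lists {t, s}" "distinct_adj ws" by (auto simp: distinct_adj_append_iff)
  moreover have "ws = [] \<or> last ws = s"
  proof (cases "ws = []")
    case False
    then have "last ws \<in> {s, t}" using snoc.prems(1) last_in_set[of ws] by auto
    then show ?thesis
      using False snoc.prems(2) \<open>e = t\<close> by (auto simp: distinct_adj_append_iff)
  qed simp
  ultimately show ?case using snoc.IH[of t s] by simp
qed simp

lemma not_distinct_adjE:
  assumes "\<not> distinct_adj ws"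
  obtains us e vs where "ws = us @ [e, e] @ vs"
  using assms
proof (induction ws arbitrary: thesis)
  case (Cons a ws)
  show ?case
  proof (cases "distinct_adj ws")
    case True
    then obtain vs where "ws = a # vs"
      using Cons.prems(2) by (cases ws) auto
    then show ?thesis using Cons.prems(1)[of "[]" a vs] by simp
  next
    case False
    then obtain us e vs where "ws = us @ [e, e] @ vs" using Cons.IH by blast
    then show ?thesis using Cons.prems(1)[of "a # us" e vs] by simp
  qed
qed simp

lemma reduced_distinct_adj:
  assumes unit: "\<And>e. e \<in> R \<Longrightarrow> lorentz e e = 1"
    and ws: "ws \<in> lists R" "length ws = word_length R (word ws)"
  shows "distinct_adj ws"
proof (rule ccontr)
  assume "\<not> distinct_adj ws"
  then obtain us e vs where eq: "ws = us @ [e, e] @ vs" by (rule not_distinct_adjE)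
  then have "hyp_reflection e \<circ> hyp_reflection e = id"
    using unit ws by (intro reflection_comp_self) auto
  then have "word ws = word (us @ vs)"
    unfolding eq word_append word_simps by (metis comp_assoc comp_id id_comp)
  moreover have "us @ vs \<in> lists R" using ws(1) eq by simp
  ultimately show False using word_length_le[of "us @ vs" R] ws(2) eq by simp
qed

text \<open>Since \<open>1 - c\<^sup>2\<close> is nonzero, Minkowski space splits into the plane of
  \<open>s\<close> and \<open>t\<close> and its orthogonal complement. Both words fix the
  complement, and on the plane they agree because the coefficients at \<open>m\<close>,
  \<open>m + 1\<close>, \<open>m + 2\<close> are 1, 0 and -1.\<close>

lemma braid_relation:
  assumes m: "m \<ge> 2" and s: "lorentz s s = 1" and t: "lorentz t t = 1"
    and st: "lorentz s t = - cos (pi / real m)"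
  shows "word (alternating m s t) = word (alternating m t s)"
proof -
  define \<theta> where "\<theta> = pi / real m"
  define c where "c = - cos \<theta>"
  have "0 < \<theta>" "\<theta> < pi" using m by (auto simp: \<theta>_def field_simps)
  then have sin: "sin \<theta> > 0" by (rule sin_gt_zero)
  have "m * \<theta> = pi" using m by (simp add: \<theta>_def)
  then have "sin ((real m - 1) * \<theta>) = sin \<theta>" "sin ((real m + 1) * \<theta>) = - sin \<theta>" "sin (m * \<theta>) = 0"
    by (simp_all add: algebra_simps sin_diff sin_add)
  then have r: "sine_ratio c m = 1" "sine_ratio c (Suc m) = 0" "sine_ratio c (Suc (Suc m)) = - 1"
    using sine_ratio_cos[of \<theta> m] sine_ratio_cos[of \<theta> "Suc m"] sine_ratio_cos[of \<theta> "Suc (Suc m)"] sin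
      mult_right_cancel[of "sin \<theta>" "sine_ratio c (Suc (Suc m))" "- 1"]
    unfolding c_def by (simp_all del: sine_ratio.simps add: add.commute)
  have st': "lorentz s t = c" "lorentz t s = c"
    using st by (simp_all add: c_def \<theta>_def lorentz_commute)
  let ?u = "word (alternating m s t)" and ?v = "word (alternating m t s)"
  have eq_s: "?u s = ?v s" and eq_t: "?u t = ?v t"
    using word_alternating[OF s t st'(1), of m] word_alternating[OF t s st'(2), of m] r by simp_all
  have "c\<^sup>2 = 1 - (sin \<theta>)\<^sup>2" unfolding c_def power2_minus cos_squared_eq ..
  then have c: "1 - c\<^sup>2 \<noteq> 0" using sin by simp
  have fix_if: "?u y = y" "?v y = y" if "lorentz y s = 0" "lorentz y t = 0" for y
    using that alternating_lists[of m s t] alternating_lists[of m t s]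
    by (auto intro!: word_fix)
  have "?u x = ?v x" for x
  proof -
    \<comment> \<open>\<open>a\<close> and \<open>b\<close> solve the Gram system of
      \<open>s\<close> and \<open>t\<close>, of determinant \<open>1 - c\<^sup>2\<close>, so that
      \<open>y\<close> is the component of \<open>x\<close> orthogonal to both.\<close>
    define a where "a = (lorentz x s - c * lorentz x t) / (1 - c\<^sup>2)"
    define b where "b = (lorentz x t - c * lorentz x s) / (1 - c\<^sup>2)"
    define y where "y = x - a *\<^sub>R s - b *\<^sub>R t"
    have "a + b * c = lorentz x s" "a * c + b = lorentz x t"
    proof -
      have "a * (1 - c\<^sup>2) = lorentz x s - c * lorentz x t"
        "b * (1 - c\<^sup>2) = lorentz x t - c * lorentz x s"
        using c by (simp_all add: a_def b_def)
      then have "(a + b * c) * (1 - c\<^sup>2) = lorentz x s * (1 - c\<^sup>2)"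
        "(a * c + b) * (1 - c\<^sup>2) = lorentz x t * (1 - c\<^sup>2)"
        by algebra+
      then show "a + b * c = lorentz x s" "a * c + b = lorentz x t" using c by simp_all
    qed
    then have y: "lorentz y s = 0" "lorentz y t = 0"
      by (simp_all add: y_def s t st')
    have x: "x = y + a *\<^sub>R s + b *\<^sub>R t" by (simp add: y_def)
    interpret u: linear ?u by (rule linear_word)
    interpret v: linear ?v by (rule linear_word)
    show ?thesis
      unfolding x u.add v.add u.scale v.scale eq_s eq_t fix_if[OF y] ..
  qed
  then show ?thesis by (rule ext)
qed

text \<open>All that Tits' argument uses about the walls. The number \<open>m\<close> is the order
  of the product of the two reflections; products at most \<open>- 1\<close> are the pairs of
  infinite order.\<close>

locale reflection_system =
  fixes R :: "'n::finite mink set"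
  assumes unit: "e \<in> R \<Longrightarrow> lorentz e e = 1"
    and angle: "s \<in> R \<Longrightarrow> t \<in> R \<Longrightarrow> s \<noteq> t \<Longrightarrow>
      lorentz s t \<le> - 1 \<or> (\<exists>m::nat. m \<ge> 2 \<and> lorentz s t = - cos (pi / real m))"
begin

text \<open>A shortest word for \<open>u\<close> cannot end in \<open>s\<close>, so it is the
  alternating word ending in \<open>t\<close>, for which the coefficients of \<open>u s\<close> are
  known. They are nonnegative if \<open>lorentz s t \<le> - 1\<close>; otherwise they are sines, and
  shortness bounds the angles by \<pi>.\<close>

lemma dihedral_nonneg:
  assumes s: "s \<in> R" and t: "t \<in> R" and "s \<noteq> t"
    and u: "u \<in> word ` lists {s, t}"
    and le: "word_length {s, t} u \<le> word_length {s, t} (u \<circ> hyp_reflection s)"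
  obtains a b where "a \<ge> 0" "b \<ge> 0" "u s = a *\<^sub>R s + b *\<^sub>R t"
proof -
  let ?I = "{s, t}"
  obtain ws where ws: "ws \<in> lists ?I" "length ws = word_length ?I u" "word ws = u"
    using u by (rule word_length_attained)
  define k where "k = length ws"
  have no_shorter: "k \<le> length vs" if "vs \<in> lists ?I" "u \<circ> hyp_reflection s = word vs" for vs
    using word_length_le[OF that(1)] le that(2) ws(2) by (simp add: k_def)
  have "distinct_adj ws"
    using ws s t unit by (intro reduced_distinct_adj[of ?I]) auto
  moreover have "ws = [] \<or> last ws = t"
  proof (rule ccontr)
    assume "\<not> ?thesis"
    then have "ws \<noteq> []" "last ws = s" using ws(1) last_in_set[of ws] by auto
    then have eq: "ws = butlast ws @ [s]" by (metis append_butlast_last_id)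
    then have "u = word (butlast ws) \<circ> hyp_reflection s"
      using ws(3) by (metis comp_id word_append word_simps)
    then have "u \<circ> hyp_reflection s = word (butlast ws)"
      using comp_reflection_cancel[OF unit[OF s]] by metis
    moreover have "butlast ws \<in> lists ?I" using ws(1) by (auto dest: in_set_butlastD)
    ultimately have "k \<le> length (butlast ws)" using no_shorter by blast
    then have "length ws \<le> length ws - 1" unfolding k_def length_butlast .
    moreover have "length ws > 0" using \<open>ws \<noteq> []\<close> by simp
    ultimately show False by linarith
  qed
  ultimately have alt: "ws = alternating k s t"
    unfolding k_def using ws(1) by (intro alternating_if_distinct_adj)
  define c where "c = lorentz s t"
  have "0 \<le> sine_ratio c (Suc k) \<and> 0 \<le> sine_ratio c (Suc (Suc k))"
  proof (cases "c \<le> - 1")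
    case True
    then show ?thesis using sine_ratio_le[of c k] sine_ratio_le[of c "Suc k"] by blast
  next
    case False
    then obtain m where m: "m \<ge> 2" "lorentz s t = - cos (pi / real m)"
      using angle[OF s t \<open>s \<noteq> t\<close>] by (auto simp: c_def)
    \<comment> \<open>From length \<open>m\<close> on, the braid relation could replace the tail of
      the word by one ending in \<open>s\<close>, and \<open>u \<circ> hyp_reflection s\<close>
      would have a word with one letter less than \<open>ws\<close>.\<close>
    have "k < m"
    proof (rule ccontr)
      assume "\<not> k < m"
      then obtain us where us: "us \<in> lists ?I" "length us = k - m"
        "alternating k s t = us @ alternating m s t"
        using alternating_add[of s t "k - m" m] by auto
      obtain l where l: "m = Suc l" using m(1) by (cases m) auto
      have "u = word us \<circ> word (alternating m s t)"
        using ws(3) alt us(3) by (metis word_append)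
      also have "\<dots> = word us \<circ> word (alternating m t s)"
        using braid_relation[OF m(1) unit[OF s] unit[OF t] m(2)] by simp
      also have "\<dots> = word (us @ alternating l s t) \<circ> hyp_reflection s"
        unfolding l alternating.simps word_append word_simps comp_id comp_assoc ..
      finally have "u \<circ> hyp_reflection s = word (us @ alternating l s t)"
        using comp_reflection_cancel[OF unit[OF s]] by metis
      then have "k \<le> length (us @ alternating l s t)"
        using us(1) alternating_lists[of l s t] by (intro no_shorter) (simp_all only: append_in_lists_conv)
      then show False using us(2) l \<open>\<not> k < m\<close> by simp
    qed
    define \<theta> where "\<theta> = pi / real m"
    have \<theta>: "0 < \<theta>" "\<theta> < pi" using m by (auto simp: \<theta>_def field_simps)
    then have "sin \<theta> > 0" by (rule sin_gt_zero)
    \<comment> \<open>The coefficients are the sines of \<open>k \<theta>\<close> and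
      \<open>(k + 1) \<theta>\<close> divided by \<open>sin \<theta>\<close>, so
      \<open>k < m\<close> just suffices: the larger angle may equal \<pi>.\<close>
    have "real (Suc k) * \<theta> \<le> real m * \<theta>"
      using \<open>k < m\<close> \<theta> by (intro mult_right_mono) auto
    then have *: "real (Suc k) * \<theta> \<le> pi"
      using m by (simp add: \<theta>_def)
    have "real k * \<theta> \<le> real (Suc k) * \<theta>"
      using \<theta> by (intro mult_right_mono) auto
    with * have "real k * \<theta> \<le> pi" by linarith
    with * have "sin (real (Suc k) * \<theta>) \<ge> 0" "sin (real k * \<theta>) \<ge> 0"
      using \<theta> by (auto intro!: sin_ge_zero)
    then have "sine_ratio c (Suc k) * sin \<theta> \<ge> 0" "sine_ratio c (Suc (Suc k)) * sin \<theta> \<ge> 0"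
      using sine_ratio_cos[of \<theta> "Suc k"] sine_ratio_cos[of \<theta> "Suc (Suc k)"] m
      by (simp_all del: sine_ratio.simps add: c_def \<theta>_def add.commute)
    then show ?thesis using \<open>sin \<theta> > 0\<close> by (simp add: zero_le_mult_iff)
  qed
  then show thesis
    using that word_alternating[OF unit[OF s] unit[OF t] c_def[symmetric], of k] alt ws(3)
    by (metis)
qed

text \<open>
  Tits' argument for the geometric representation, run inside the group itself: the factorisation
  \<open>w = v \<circ> u\<close> with \<open>u\<close> in the dihedral group of \<open>s\<close> and the last letter \<open>t\<close> of \<open>w\<close>, and \<open>v\<close> shortest
  possible, reduces the claim to the dihedral case.
\<close>

theorem root_nonpos:
  assumes x: "\<And>e. e \<in> R \<Longrightarrow> lorentz x e \<le> 0"
    and "w \<in> word ` lists R" "s \<in> R"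
    and "word_length R w \<le> word_length R (w \<circ> hyp_reflection s)"
  shows "lorentz x (w s) \<le> 0"
  using assms(2-)
proof (induction "word_length R w" arbitrary: w s rule: less_induct)
  case less
  note w = less.prems(1) and s = less.prems(2)
  let ?l = "word_length R"
  obtain ws where ws: "ws \<in> lists R" "length ws = ?l w" "word ws = w"
    using w by (rule word_length_attained)
  show ?case
  proof (cases "ws = []")
    case True
    then show ?thesis using x[OF s] ws by auto
  next
    case False
    then obtain us t where us: "ws = us @ [t]" by (metis rev_exhaust)
    then have t: "t \<in> R" and us_R: "us \<in> lists R" using ws by auto
    have w_us: "w = word us \<circ> hyp_reflection t" using ws us by (metis comp_id word_append word_simps)
    then have wt: "w \<circ> hyp_reflection t = word us"
      using comp_reflection_cancel[OF unit[OF t]] by metis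
    have lwt: "?l (word us) < ?l w" using word_length_le[OF us_R] ws us by simp
    have "s \<noteq> t" using less.prems(3) wt lwt by auto
    let ?I = "{s, t}"
    have I: "?I \<subseteq> R" using s t by auto
    \<comment> \<open>The left factors in factorisations of \<open>w\<close> whose lengths add up.
      As \<open>word us\<close> is one of them and shorter than \<open>w\<close>, a shortest
      \<open>v\<close> is within reach of the induction hypothesis.\<close>
    define A where "A = {v \<in> word ` lists R. \<exists>u \<in> word ` lists ?I.
      w = v \<circ> u \<and> ?l w = ?l v + word_length ?I u}"
    have "word us \<in> A"
    proof -
      have "?l w \<le> ?l (word us) + ?l (hyp_reflection t)"
        unfolding w_us using us_R t by (intro word_length_comp_le imageI reflection_word)
      moreover have "?l (hyp_reflection t) \<le> word_length ?I (hyp_reflection t)"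
        using I by (intro word_length_mono reflection_word) auto
      moreover have "word_length ?I (hyp_reflection t) \<le> 1"
        by (rule reflection_word_length) simp
      ultimately have "?l w = ?l (word us) + word_length ?I (hyp_reflection t)"
        using lwt by linarith
      moreover have "hyp_reflection t \<in> word ` lists ?I" by (rule reflection_word) simp
      ultimately show ?thesis unfolding A_def using w_us us_R by blast
    qed
    then obtain v where v: "v \<in> A" and v_min: "\<And>v'. v' \<in> A \<Longrightarrow> ?l v \<le> ?l v'"
      using exists_least_iff[of "\<lambda>n. \<exists>v\<in>A. ?l v = n"] by (metis not_le_imp_less)
    then obtain u where v_R: "v \<in> word ` lists R" and u: "u \<in> word ` lists ?I"
      and w_vu: "w = v \<circ> u" and len: "?l w = ?l v + word_length ?I u"
      unfolding A_def by blast
    have "?l v < ?l w" using v_min[OF \<open>word us \<in> A\<close>] lwt by simp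
    \<comment> \<open>If \<open>r\<close> shortened \<open>v\<close>, it could be moved over to
      \<open>u\<close>, giving an element of \<open>A\<close> below the minimum.\<close>
    have v_nonpos: "lorentz x (v r) \<le> 0" if r: "r \<in> ?I" for r
    proof (rule less.hyps[OF \<open>?l v < ?l w\<close> v_R])
      show "r \<in> R" using r I by blast
      show "?l v \<le> ?l (v \<circ> hyp_reflection r)"
      proof (rule ccontr)
        assume lt: "\<not> ?thesis"
        have ru: "hyp_reflection r \<circ> u \<in> word ` lists ?I"
          using r u by (intro word_comp reflection_word)
        have vr: "v \<circ> hyp_reflection r \<in> word ` lists R"
          using \<open>r \<in> R\<close> v_R by (intro word_comp reflection_word)
        have w': "w = (v \<circ> hyp_reflection r) \<circ> (hyp_reflection r \<circ> u)"
          unfolding w_vu using comp_reflection_cancel[OF unit[OF \<open>r \<in> R\<close>], of v]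
          by (metis comp_assoc)
        have "?l w \<le> ?l (v \<circ> hyp_reflection r) + ?l (hyp_reflection r \<circ> u)"
          unfolding w' using vr ru lists_mono[OF I]
          by (intro word_length_comp_le) auto
        moreover have "?l (hyp_reflection r \<circ> u) \<le> word_length ?I (hyp_reflection r \<circ> u)"
          by (rule word_length_mono[OF ru I])
        moreover have "word_length ?I (hyp_reflection r \<circ> u) \<le> 1 + word_length ?I u"
          using word_length_comp_le[OF reflection_word[OF r] u] reflection_word_length[OF r]
          by linarith
        ultimately have "?l w = ?l (v \<circ> hyp_reflection r) + word_length ?I (hyp_reflection r \<circ> u)"
          using lt len by linarith
        then have "v \<circ> hyp_reflection r \<in> A"
          unfolding A_def using vr ru w' by blast
        then show False using v_min lt by blast
      qed
    qed
    \<comment> \<open>If \<open>s\<close> shortened \<open>u\<close>, it would shorten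
      \<open>w\<close> as well, against the hypothesis.\<close>
    have "word_length ?I u \<le> word_length ?I (u \<circ> hyp_reflection s)"
    proof (rule ccontr)
      assume lt: "\<not> ?thesis"
      have us: "u \<circ> hyp_reflection s \<in> word ` lists ?I"
        using u by (intro word_comp reflection_word) auto
      have "?l (w \<circ> hyp_reflection s) \<le> ?l v + ?l (u \<circ> hyp_reflection s)"
        unfolding w_vu comp_assoc using v_R us lists_mono[OF I]
        by (intro word_length_comp_le) auto
      then show False
        using word_length_mono[OF us I] lt len less.prems(3) by linarith
    qed
    then obtain a b where ab: "a \<ge> 0" "b \<ge> 0" "u s = a *\<^sub>R s + b *\<^sub>R t"
      using dihedral_nonneg[OF s t \<open>s \<noteq> t\<close> u] by blast
    have "linear v" using v_R linear_word by (metis imageE)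
    then have "w s = a *\<^sub>R v s + b *\<^sub>R v t"
      unfolding w_vu comp_apply ab(3) by (simp add: linear_add linear_scale)
    then show ?thesis
      using v_nonpos ab(1,2) by (simp add: add_nonpos_nonpos mult_nonneg_nonpos)
  qed
qed

end

subsection \<open>Walls of a polyhedron\<close>

definition orthogonal_space :: "'n::finite mink \<Rightarrow> 'n mink set" where
  "orthogonal_space e = {y. lorentz y e = 0}"

lemma subspace_orthogonal_space: "subspace (orthogonal_space e)"
  by (auto simp: orthogonal_space_def subspace_def)

lemma dim_orthogonal_space:
  fixes e :: "'n::finite mink"
  assumes "e \<noteq> 0"
  shows "dim (orthogonal_space e) = CARD('n)"
proof -
  let ?a = "(- fst e, snd e)"
  have "orthogonal_space e = {x. ?a \<bullet> x = 0}"
    by (simp add: orthogonal_space_def lorentz_inner inner_commute)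
  moreover have "?a \<noteq> 0" using assms by (cases e) (simp add: zero_prod_def)
  ultimately show ?thesis using dim_hyperplane[of ?a] by simp
qed

text \<open>Inclusion of the hyperplanes makes the normals proportional, unit length leaves a sign,
  and \<open>x\<close> on the negative side of both fixes it.\<close>

lemma orthogonal_space_subset_unique:
  assumes e: "lorentz e e = 1" and g: "lorentz g g = 1"
    and sub: "orthogonal_space e \<subseteq> orthogonal_space g"
    and x: "lorentz x e < 0" "lorentz x g < 0"
  shows "g = e"
proof -
  have eq: "lorentz y g = lorentz y e * lorentz e g" for y
  proof -
    have "y - lorentz y e *\<^sub>R e \<in> orthogonal_space e" by (simp add: orthogonal_space_def e)
    then have "y - lorentz y e *\<^sub>R e \<in> orthogonal_space g" using sub by blast
    then show ?thesis by (simp add: orthogonal_space_def)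
  qed
  have "lorentz e g > 0"
    using eq[of x] x by (metis mult_less_0_iff not_less_iff_gr_or_eq)
  moreover have "(lorentz e g)\<^sup>2 = 1"
    using eq[of g] g lorentz_commute[of g e] by (simp add: power2_eq_square)
  ultimately have "lorentz e g = 1" by (simp add: power2_eq_1_iff)
  then have "lorentz y (g - e) = 0" for y using eq[of y] by simp
  then have "g - e = 0" by (rule lorentz_nondegenerate)
  then show ?thesis by simp
qed

lemma face_span_subset: "span (face P e) \<subseteq> orthogonal_space e"
  by (rule span_minimal[OF _ subspace_orthogonal_space])
    (auto simp: face_def hyp_hyperplane_def orthogonal_space_def)

lemma wall_face_span:
  assumes "e \<in> walls P"
  shows "span (face P e) = orthogonal_space e"
proof -
  have "lorentz e e = 1" "dim (face P e) = CARD('a)" using assms by (simp_all add: walls_def)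
  then have "e \<noteq> 0" by auto
  then show ?thesis
    using dim_orthogonal_space[OF \<open>e \<noteq> 0\<close>] \<open>dim (face P e) = CARD('a)\<close> face_span_subset
    by (intro subspace_dim_equal subspace_span subspace_orthogonal_space)
      (simp_all add: dim_span)
qed

text \<open>One relatively interior point serves for all half-spaces: were it on the boundary of
  one, a small step along the outward normal would stay in \<open>P\<close> and yet leave the
  half-space.\<close>

lemma interior_strict:
  assumes "top_of_set hyp interior_of P \<noteq> {}"
  obtains x where "x \<in> hyp" "\<And>e. lorentz e e = 1 \<Longrightarrow> P \<subseteq> hyp_halfspace e \<Longrightarrow> lorentz x e < 0"
proof -
  obtain x U where xU: "openin (top_of_set hyp) U" "x \<in> U" "U \<subseteq> P"
    using assms by (auto simp: interior_of_def)
  then obtain T where T: "open T" "U = hyp \<inter> T" by (auto simp: openin_open)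
  have x: "x \<in> hyp" "x \<in> T" using xU T by auto
  moreover have "lorentz x e < 0" if e: "lorentz e e = 1" and sub: "P \<subseteq> hyp_halfspace e" for e
  proof (rule ccontr)
    assume "\<not> ?thesis"
    moreover have "lorentz x e \<le> 0" using xU sub by (auto simp: hyp_halfspace_def)
    ultimately have xe: "lorentz x e = 0" by simp
    \<comment> \<open>\<open>x + s e\<close> has self-product \<open>s\<^sup>2 - 1\<close>, whence
      the factor that puts it back on the hyperboloid.\<close>
    define y where "y s = (1 / sqrt (1 - s\<^sup>2)) *\<^sub>R (x + s *\<^sub>R e)" for s :: real
    have "(y \<longlongrightarrow> (1 / sqrt (1 - 0\<^sup>2)) *\<^sub>R (x + 0 *\<^sub>R e)) (at_right 0)"
      unfolding y_def by (intro tendsto_intros) simp_all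
    then have "eventually (\<lambda>s. y s \<in> T) (at_right 0)"
      using T(1) x(2) by (auto simp: tendsto_def)
    moreover have "eventually (\<lambda>s::real. 0 < s \<and> s < 1) (at_right 0)"
      using eventually_at_right_real[of 0 1] by simp
    ultimately have "eventually (\<lambda>s. y s \<in> T \<and> 0 < s \<and> s < 1) (at_right 0)"
      by eventually_elim simp
    then obtain s where s: "y s \<in> T" "0 < s" "s < 1"
      using eventually_happens trivial_limit_at_right_real by blast
    have s2: "s\<^sup>2 < 1" using s by (simp add: abs_square_less_1)
    have xx: "lorentz x x = - 1" "x \<in> future" using x by (simp_all add: hyp_future)
    have self: "lorentz (x + s *\<^sub>R e) (x + s *\<^sub>R e) = s\<^sup>2 - 1"
      using xx xe e by (simp add: lorentz_commute[of e x] power2_eq_square)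
    have "x + s *\<^sub>R e \<in> future"
      using xx xe s2 by (intro future_timelike[OF xx(2)]) (simp_all add: self del: lorentz_linear, simp)
    then have "y s \<in> future" using s2 by (simp add: y_def future_scale)
    have "lorentz (y s) (y s) = (1 / sqrt (1 - s\<^sup>2))\<^sup>2 * (s\<^sup>2 - 1)"
      unfolding y_def lorentz_linear(7,8) self by (simp add: power2_eq_square)
    moreover have "(1 / sqrt (1 - s\<^sup>2))\<^sup>2 = 1 / (1 - s\<^sup>2)" using s2 by (simp add: power_divide)
    moreover have "1 / (1 - s\<^sup>2) * (s\<^sup>2 - 1) = - 1" using s2 by (simp add: divide_eq_eq)
    ultimately have "lorentz (y s) (y s) = - 1" by metis
    with \<open>y s \<in> future\<close> have "y s \<in> P" using s(1) xU T by (auto simp: hyp_future)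
    then have "lorentz (y s) e \<le> 0" using sub by (auto simp: hyp_halfspace_def)
    moreover have "lorentz (y s) e > 0" using s s2 xe e by (simp add: y_def)
    ultimately show False by simp
  qed
  ultimately show thesis using that by blast
qed

text \<open>A description of \<open>P\<close> by as few normals as possible consists exactly of the
  walls: irredundancy makes each face span its hyperplane, and a wall missing from the description
  could be crossed without leaving \<open>P\<close>.\<close>

lemma polyhedron_walls:
  fixes P :: "'n::finite mink set"
  assumes "hyp_polyhedron P"
  shows "finite (walls P)" and "P = {x \<in> hyp. \<forall>e\<in>walls P. lorentz x e \<le> 0}"
proof -
  obtain x0 where x0: "x0 \<in> hyp"
    and strict: "\<And>e. lorentz e e = 1 \<Longrightarrow> P \<subseteq> hyp_halfspace e \<Longrightarrow> lorentz x0 e < 0"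
    using assms interior_strict[of P] unfolding hyp_polyhedron_def by metis
  have x0f: "x0 \<in> future" using x0 by (simp add: hyp_future)
  define desc where "desc N \<longleftrightarrow> finite N \<and> (\<forall>e\<in>N. lorentz e e = 1) \<and>
    P = {x \<in> hyp. \<forall>e\<in>N. lorentz x e \<le> 0}" for N :: "'n mink set"
  obtain N0 where N0: "desc N0"
  proof -
    obtain N where N: "finite N" "\<forall>e\<in>N. lorentz e e = 1" "P = hyp \<inter> (\<Inter>e\<in>N. hyp_halfspace e)"
      using assms by (auto simp: hyp_polyhedron_def)
    have "hyp \<inter> (\<Inter>e\<in>N. hyp_halfspace e) = {x \<in> hyp. \<forall>e\<in>N. lorentz x e \<le> 0}"
      by (auto simp: hyp_halfspace_def)
    then have "desc N" using N unfolding desc_def by simp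
    then show thesis by (rule that)
  qed
  obtain N where N: "desc N" and mn: "\<And>M. desc M \<Longrightarrow> card N \<le> card M"
    using ex_has_least_nat[of desc, OF N0, of card] by blast
  have fin: "finite N" and unit: "\<And>e. e \<in> N \<Longrightarrow> lorentz e e = 1"
    and P: "P = {x \<in> hyp. \<forall>e\<in>N. lorentz x e \<le> 0}"
    using N by (simp_all add: desc_def)
  have P_iff: "x \<in> P \<longleftrightarrow> x \<in> hyp \<and> (\<forall>e\<in>N. lorentz x e \<le> 0)" for x
    by (subst P) simp
  have half: "P \<subseteq> hyp_halfspace e" if "e \<in> N" for e
    using that by (auto simp: hyp_halfspace_def P_iff)
  have x0N: "lorentz x0 e < 0" if "e \<in> N" for e
    using strict[OF unit half] that by blast
  have cone: "\<exists>c>0. c *\<^sub>R x \<in> P" 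
    if x: "x \<in> future" "\<And>g. g \<in> N \<Longrightarrow> lorentz x g \<le> 0" for x
  proof -
    obtain c where "c > 0" "c *\<^sub>R x \<in> hyp" by (rule future_normalize[OF x(1)])
    then show ?thesis using x(2) by (auto simp: mult_le_0_iff P_iff)
  qed
  have "e \<in> walls P" if e: "e \<in> N" for e
  proof -
    have "\<not> desc (N - {e})" using mn[of "N - {e}"] card_Diff1_less[OF fin e] by (meson not_le)
    then have "P \<noteq> {x \<in> hyp. \<forall>g\<in>N - {e}. lorentz x g \<le> 0}"
      using fin unit by (simp add: desc_def)
    then obtain x where neq: "(x \<in> P) \<noteq> (x \<in> {x \<in> hyp. \<forall>g\<in>N - {e}. lorentz x g \<le> 0})"
      unfolding set_eq_iff by blast
    have x: "x \<in> hyp" "\<And>g. g \<in> N - {e} \<Longrightarrow> lorentz x g \<le> 0" "lorentz x e > 0"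
    proof -
      have "x \<in> P \<longleftrightarrow> x \<in> hyp \<and> lorentz x e \<le> 0 \<and> (\<forall>g\<in>N - {e}. lorentz x g \<le> 0)"
        unfolding P_iff using e by blast
      then have "x \<in> hyp \<and> (\<forall>g\<in>N - {e}. lorentz x g \<le> 0) \<and> \<not> lorentz x e \<le> 0"
        using neq unfolding mem_Collect_eq by argo
      then show "x \<in> hyp" "\<And>g. g \<in> N - {e} \<Longrightarrow> lorentz x g \<le> 0" "lorentz x e > 0"
        by (simp_all add: not_le)
    qed
    \<comment> \<open>Up to scale, the point where the segment from \<open>x0\<close> to
      \<open>x\<close> crosses the hyperplane of \<open>e\<close>. As \<open>x\<close> violates
      \<open>e\<close> alone, \<open>z\<close> is strict for the other normals and can be perturbed
      freely within the hyperplane.\<close>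
    define z where "z = lorentz x e *\<^sub>R x0 + (- lorentz x0 e) *\<^sub>R x"
    have zf: "z \<in> future"
      unfolding z_def using x x0N[OF e] x0 by (intro future_add future_scale) (auto simp: hyp_future)
    have ze: "lorentz z e = 0" by (simp add: z_def)
    have zg: "lorentz z g < 0" if "g \<in> N - {e}" for g
    proof -
      have "lorentz x e * lorentz x0 g < 0" using x0N that x by (simp add: mult_pos_neg)
      moreover have "- lorentz x0 e * lorentz x g \<le> 0"
        using x0N[OF e] x(2)[OF that] by (intro mult_nonneg_nonpos) auto
      ultimately show ?thesis by (simp add: z_def)
    qed
    have in_face: "w \<in> span (face P e)" if w: "w \<in> future" "lorentz w e = 0"
      "\<And>g. g \<in> N - {e} \<Longrightarrow> lorentz w g < 0" for w
    proof -
      have "lorentz w g \<le> 0" if "g \<in> N" for g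
        using w(2) w(3)[of g] that by (cases "g = e") auto
      then obtain c where c: "c > 0" "c *\<^sub>R w \<in> P" using cone[OF w(1)] by blast
      then have "c *\<^sub>R w \<in> hyp" by (simp add: P_iff)
      then have "c *\<^sub>R w \<in> face P e"
        using c w(2) by (simp add: face_def hyp_hyperplane_def)
      then have "(1 / c) *\<^sub>R c *\<^sub>R w \<in> span (face P e)" by (intro span_scale span_base)
      then show ?thesis using c by simp
    qed
    have "orthogonal_space e \<subseteq> span (face P e)"
    proof
      fix y assume "y \<in> orthogonal_space e"
      then have y: "lorentz y e = 0" by (simp add: orthogonal_space_def)
      obtain s where s: "s > 0" "z + s *\<^sub>R y \<in> future" "\<And>g. g \<in> N - {e} \<Longrightarrow> lorentz (z + s *\<^sub>R y) g < 0"
        using perturb_strict[of "N - {e}" z y] fin zf zg by blast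
      have "z + s *\<^sub>R y \<in> span (face P e)" "z \<in> span (face P e)"
        using s ze y zf zg by (auto intro!: in_face simp del: lorentz_linear)
          (simp_all add: ze y)
      then have "(1 / s) *\<^sub>R ((z + s *\<^sub>R y) - z) \<in> span (face P e)"
        by (intro span_scale span_diff)
      then show "y \<in> span (face P e)" using s by simp
    qed
    then have "span (face P e) = orthogonal_space e" using face_span_subset by blast
    moreover have "e \<noteq> 0" using unit[OF e] by auto
    ultimately have "dim (face P e) = CARD('n)"
      using dim_orthogonal_space[of e] by (metis dim_span)
    then show ?thesis using unit[OF e] half[OF e] by (simp add: walls_def)
  qed
  moreover have "e \<in> N" if e: "e \<in> walls P" for e
  proof -
    have e': "lorentz e e = 1" "P \<subseteq> hyp_halfspace e" using e by (auto simp: walls_def)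
    have "\<exists>g\<in>N. \<forall>x\<in>face P e. lorentz x g = 0"
    proof (rule ccontr)
      assume "\<not> ?thesis"
      then have "\<forall>g\<in>N. \<exists>x\<in>face P e. lorentz x g \<noteq> 0" by blast
      then obtain q where q: "\<And>g. g \<in> N \<Longrightarrow> q g \<in> face P e" "\<And>g. g \<in> N \<Longrightarrow> lorentz (q g) g \<noteq> 0"
        by metis
      have "face P e \<noteq> {}"
        using e by (auto simp: walls_def)
      then obtain p where p: "p \<in> face P e" by blast
      have faceD: "y \<in> future" "lorentz y e = 0" "\<And>g. g \<in> N \<Longrightarrow> lorentz y g \<le> 0"
        if "y \<in> face P e" for y
        using that by (auto simp: P_iff face_def hyp_hyperplane_def hyp_future)
      \<comment> \<open>Each \<open>q g\<close> is off the hyperplane of \<open>g\<close>, so the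
        sum is strict for all of \<open>N\<close>. The summand \<open>p\<close> keeps it in the cone
        when \<open>N\<close> is empty.\<close>
      define z where "z = p + (\<Sum>g\<in>N. q g)"
      have lin: "lorentz z y = lorentz p y + (\<Sum>g\<in>N. lorentz (q g) y)" for y
        by (simp add: z_def lorentz_inner inner_sum_left inner_add_left)
      have "p + (\<Sum>g\<in>M. q g) \<in> future" if "M \<subseteq> N" for M
        using finite_subset[OF that fin] that
      proof (induction M rule: finite_induct)
        case empty
        then show ?case using faceD(1)[OF p] by simp
      next
        case (insert h M)
        then have "q h + (p + sum q M) \<in> future"
          by (intro future_add[OF faceD(1)[OF q(1)]]) simp_all
        then show ?case using insert.hyps by (simp add: add.left_commute)
      qed
      then have zf: "z \<in> future" unfolding z_def by blast
      have ze: "lorentz z e = 0" unfolding lin using faceD(2) p q(1) by simp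
      have zg: "lorentz z g < 0" if g: "g \<in> N" for g
      proof -
        have "(\<Sum>h\<in>N. lorentz (q h) g) = lorentz (q g) g + (\<Sum>h\<in>N - {g}. lorentz (q h) g)"
          using fin g by (rule sum.remove)
        moreover have "(\<Sum>h\<in>N - {g}. lorentz (q h) g) \<le> 0"
          using faceD(3) q(1) g by (intro sum_nonpos) auto
        moreover have "lorentz (q g) g < 0" using faceD(3)[OF q(1)[OF g] g] q(2)[OF g] by simp
        moreover have "lorentz p g \<le> 0" using faceD(3)[OF p g] .
        ultimately show ?thesis unfolding lin by linarith
      qed
      obtain s where s: "s > 0" "z + s *\<^sub>R e \<in> future" "\<And>g. g \<in> N \<Longrightarrow> lorentz (z + s *\<^sub>R e) g < 0"
        using perturb_strict[OF fin zf zg] by blast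
      then obtain c where c: "c > 0" "c *\<^sub>R (z + s *\<^sub>R e) \<in> P"
        using cone[of "z + s *\<^sub>R e"] less_imp_le by metis
      then have "lorentz (c *\<^sub>R (z + s *\<^sub>R e)) e \<le> 0" using e' by (auto simp: hyp_halfspace_def)
      then show False using c s ze e' by (simp add: mult_le_0_iff)
    qed
    then obtain g where g: "g \<in> N" "\<forall>x\<in>face P e. lorentz x g = 0" by blast
    then have "span (face P e) \<subseteq> orthogonal_space g"
      by (intro span_minimal subspace_orthogonal_space) (auto simp: orthogonal_space_def)
    then have "g = e"
      using orthogonal_space_subset_unique[of e g x0] wall_face_span[OF e] e' unit[OF g(1)]
        x0N[OF g(1)] strict[of e] by blast
    then show ?thesis using g by simp
  qed
  ultimately have "walls P = N" by blast
  then show "finite (walls P)" "P = {x \<in> hyp. \<forall>e\<in>walls P. lorentz x e \<le> 0}"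
    using fin P by simp_all
qed

subsection \<open>Disjoint faces of a Coxeter polyhedron\<close>

locale coxeter =
  fixes P :: "'n::finite mink set"
  assumes coxeter: "coxeter_polyhedron P"
begin

lemma polyhedron: "hyp_polyhedron P"
  using coxeter by (simp add: coxeter_polyhedron_def)

lemma finite_walls: "finite (walls P)"
  using polyhedron_walls(1)[OF polyhedron] .

lemma P_iff: "x \<in> P \<longleftrightarrow> x \<in> hyp \<and> (\<forall>e\<in>walls P. lorentz x e \<le> 0)"
  by (subst polyhedron_walls(2)[OF polyhedron]) simp

lemma P_future: "x \<in> P \<Longrightarrow> x \<in> future"
  by (simp add: P_iff hyp_future)

lemma wall_unit: "e \<in> walls P \<Longrightarrow> lorentz e e = 1"
  by (simp add: walls_def)

lemma interior_point:
  obtains x where "x \<in> P" "\<And>e. e \<in> walls P \<Longrightarrow> lorentz x e < 0"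
proof -
  have "top_of_set hyp interior_of P \<noteq> {}" using polyhedron by (simp add: hyp_polyhedron_def)
  then obtain x where x: "x \<in> hyp"
    "\<And>e. lorentz e e = 1 \<Longrightarrow> P \<subseteq> hyp_halfspace e \<Longrightarrow> lorentz x e < 0"
    by (rule interior_strict) blast
  have neg: "lorentz x e < 0" if "e \<in> walls P" for e
    using that x(2)[of e] by (simp add: walls_def)
  moreover have "x \<in> P" using x(1) neg by (simp add: P_iff less_imp_le)
  ultimately show thesis using that by blast
qed

lemma normalize_P:
  assumes "x \<in> future" "\<And>e. e \<in> walls P \<Longrightarrow> lorentz x e \<le> 0"
  obtains c where "c > 0" "c *\<^sub>R x \<in> P"
proof -
  obtain c where "c > 0" "c *\<^sub>R x \<in> hyp" by (rule future_normalize[OF assms(1)])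
  then show thesis using that[of c] assms(2) by (simp add: P_iff lorentz_pos_multiple_iff del: lorentz_linear)
qed

lemma wall_face_point:
  assumes "e \<in> walls P"
  obtains p where "p \<in> P" "lorentz p e = 0"
proof -
  have "face P e \<noteq> {}" using assms by (auto simp: walls_def)
  then show thesis using that by (auto simp: face_def hyp_hyperplane_def)
qed

text \<open>\<open>e + f\<close> and \<open>e - f\<close> are nonzero and orthogonal to the timelike
  \<open>p\<close>, hence spacelike. This puts \<open>lorentz e f\<close> strictly between -1 and 1,
  so the arccosine can be inverted and \<open>m = 1\<close> is excluded.\<close>

lemma intersecting_angle:
  assumes e: "e \<in> walls P" and f: "f \<in> walls P" and "e \<noteq> f"
    and p: "p \<in> P" "lorentz p e = 0" "lorentz p f = 0"
  obtains m :: nat where "m \<ge> 2" "lorentz e f = - cos (pi / real m)"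
proof -
  have pf: "p \<in> future" using P_future p by simp
  have units: "lorentz e e = 1" "lorentz f f = 1" using wall_unit e f by auto
  have "e + f \<noteq> 0"
  proof
    assume "e + f = 0"
    then have "f = - e" by (simp add: eq_neg_iff_add_eq_0 add.commute)
    then show False using interior_point e f
      by (metis less_asym lorentz_linear(6) neg_less_0_iff_less)
  qed
  then have "lorentz (e + f) (e + f) > 0" using p by (intro future_orthogonal[OF pf]) simp_all
  then have gt: "lorentz e f > - 1" using units by (simp add: lorentz_commute[of f e])
  have "lorentz (e - f) (e - f) > 0" using p \<open>e \<noteq> f\<close> by (intro future_orthogonal[OF pf]) simp_all
  then have lt: "lorentz e f < 1" using units by (simp add: lorentz_commute[of f e])
  have "p \<in> face P e \<inter> face P f"
    using p by (simp add: face_def hyp_hyperplane_def P_iff)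
  then obtain m :: nat where m: "m > 0" "dihedral_angle e f = pi / real m"
    using coxeter e f \<open>e \<noteq> f\<close> unfolding coxeter_polyhedron_def by blast
  have eq: "lorentz e f = - cos (pi / real m)"
    using cos_arccos[of "- lorentz e f"] gt lt unfolding m(2)[symmetric] dihedral_angle_def by simp
  moreover have "m \<noteq> 1" using eq lt by auto
  ultimately show thesis using that[of m] m(1) by simp
qed

lemma cos_angle_nonneg: "m \<ge> 2 \<Longrightarrow> cos (pi / real m) \<ge> 0"
  by (intro cos_ge_zero) (auto simp: field_simps intro: order_trans[of _ 0])

lemma intersecting_nonpos:
  assumes "e \<in> walls P" "f \<in> walls P" "e \<noteq> f" "p \<in> P" "lorentz p e = 0" "lorentz p f = 0"
  shows "lorentz e f \<le> 0"
  using intersecting_angle[OF assms] cos_angle_nonneg by (metis neg_le_0_iff_le)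

text \<open>
  As all dihedral angles are non-obtuse, the orthogonal projection to the hyperplane of a face maps
  \<open>P\<close> into that face.
\<close>

lemma projection_nonpos:
  assumes e: "e \<in> walls P" and x: "x \<in> future" "\<And>g. g \<in> walls P \<Longrightarrow> lorentz x g \<le> 0"
  shows "x - lorentz x e *\<^sub>R e \<in> future"
    and "h \<in> walls P \<Longrightarrow> lorentz (x - lorentz x e *\<^sub>R e) h \<le> 0"
proof -
  let ?y = "x - lorentz x e *\<^sub>R e"
  have ee: "lorentz e e = 1" using wall_unit[OF e] .
  have xx: "lorentz x x < 0" using x by (simp add: future_iff)
  have "lorentz ?y ?y = lorentz x x - (lorentz x e)\<^sup>2" "lorentz x ?y = lorentz x x - (lorentz x e)\<^sup>2"
    using ee by (simp_all add: lorentz_commute[of e x] power2_eq_square algebra_simps)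
  moreover have "lorentz x x - (lorentz x e)\<^sup>2 < 0" using xx by (smt (verit) zero_le_power2)
  ultimately show yf: "?y \<in> future"
    by (intro future_timelike[OF x(1)]) simp_all
  have ye: "lorentz ?y e = 0" using ee by simp
  show "lorentz ?y h \<le> 0" if h: "h \<in> walls P"
  proof (rule ccontr)
    assume neg: "\<not> ?thesis"
    \<comment> \<open>The segment from a point \<open>q\<close> of the face to the projection runs
      in the hyperplane of \<open>e\<close> and would leave \<open>P\<close> at a point common to
      the faces of \<open>e\<close> and some \<open>g\<close>. The non-obtuse angle there gives
      \<open>lorentz ?y g \<le> 0\<close>, so the segment cannot end beyond
      \<open>g\<close>.\<close>
    obtain q where q: "q \<in> P" "lorentz q e = 0" using wall_face_point[OF e] .
    define d where "d = ?y - q"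
    have q_le: "lorentz q g \<le> 0" if "g \<in> walls P" for g using q that by (simp add: P_iff)
    have dh: "lorentz d h > 0" using neg q_le[OF h] unfolding d_def lorentz_linear(3) by linarith
    obtain s g where s: "s \<ge> 0" and g: "g \<in> walls P" "lorentz d g > 0"
      and zg: "lorentz (q + s *\<^sub>R d) g = 0"
      and z_le: "\<forall>k\<in>walls P. lorentz (q + s *\<^sub>R d) k \<le> 0"
      by (rule ray_exit[OF finite_walls q_le h dh])
    have yd: "?y = q + d" by (simp add: d_def)
    have "s < 1"
    proof (rule ccontr)
      assume "\<not> s < 1"
      then have "lorentz d h \<le> s * lorentz d h" using \<open>lorentz d h > 0\<close> by simp
      then show False using bspec[OF z_le h] neg unfolding yd by simp
    qed
    have "q + s *\<^sub>R d = (1 - s) *\<^sub>R q + s *\<^sub>R ?y" unfolding yd by (simp add: algebra_simps)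
    then have "q + s *\<^sub>R d \<in> future"
      using future_combination[OF P_future[OF q(1)] yf s] \<open>s < 1\<close> by simp
    then obtain c where c: "c > 0" "c *\<^sub>R (q + s *\<^sub>R d) \<in> P"
      by (rule normalize_P) (use z_le in blast)
    have de: "lorentz d e = 0" using q ye by (simp add: d_def)
    have "lorentz e g \<le> 0"
    proof (rule intersecting_nonpos[OF e g(1) _ c(2)])
      show "e \<noteq> g" using de g by auto
      show "lorentz (c *\<^sub>R (q + s *\<^sub>R d)) e = 0" using q de by simp
      show "lorentz (c *\<^sub>R (q + s *\<^sub>R d)) g = 0" unfolding lorentz_linear(7) zg by simp
    qed
    then have "lorentz x e * lorentz e g \<ge> 0" using x(2)[OF e] by (simp add: mult_nonpos_nonpos)
    then have "lorentz ?y g \<le> 0" using x(2)[OF g(1)] by simp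
    moreover have "lorentz ?y g = lorentz (q + s *\<^sub>R d) g + (1 - s) * lorentz d g"
      unfolding yd by (simp add: algebra_simps)
    moreover have "(1 - s) * lorentz d g > 0" using g \<open>s < 1\<close> by simp
    ultimately show False using zg by linarith
  qed
qed

text \<open>
  Projecting alternately to two disjoint faces never leaves \<open>P\<close>.  If the hyperplanes met, the
  projections would converge to a common point of the two faces.
\<close>

lemma disjoint_faces:
  assumes e: "e \<in> walls P" and f: "f \<in> walls P"
    and disj: "\<And>p. p \<in> P \<Longrightarrow> lorentz p e = 0 \<Longrightarrow> lorentz p f \<noteq> 0"
  shows "lorentz e f \<le> - 1"
proof (rule ccontr)
  assume gt: "\<not> ?thesis"
  define c where "c = lorentz e f"
  have ee: "lorentz e e = 1" "lorentz f f = 1" and fe: "lorentz e f = c" "lorentz f e = c"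
    using wall_unit e f by (simp_all add: c_def lorentz_commute)
  obtain x where x: "x \<in> P" "lorentz x e = 0" using wall_face_point[OF e] .
  have xf: "x \<in> future" and x_le: "\<And>g. g \<in> walls P \<Longrightarrow> lorentz x g \<le> 0"
    using x P_future by (simp_all add: P_iff)
  define a where "a = lorentz x f"
  have "a < 0" using disj[OF x] x_le[OF f] by (simp add: a_def)
  \<comment> \<open>\<open>x\<close> is on the face of \<open>e\<close>. Projecting it to the face
    of \<open>f\<close> changes its product with \<open>e\<close> from 0 to \<open>- a * c\<close>,
    which must not be positive.\<close>
  have "c \<le> 0"
    using projection_nonpos(2)[OF f xf x_le e] \<open>a < 0\<close> x fe
    by (simp add: a_def[symmetric] mult_le_0_iff zero_le_mult_iff)
  then have "\<bar>c\<bar> < 1" using gt by (simp add: c_def)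
  then have c2: "c\<^sup>2 < 1" by (simp add: abs_square_less_1)
  \<comment> \<open>\<open>y k\<close> results from \<open>k\<close> rounds of projecting
    \<open>x\<close> to \<open>f\<close> and back to \<open>e\<close>. The direction is the part of
    \<open>f\<close> orthogonal to \<open>e\<close>, and each round multiplies the product with
    \<open>f\<close> by \<open>c\<^sup>2\<close>, whence the geometric sums.\<close>
  define b where "b k = a * (\<Sum>i<k. (c\<^sup>2) ^ i)" for k
  define y where "y k = x - b k *\<^sub>R (f - c *\<^sub>R e)" for k
  have yf_eq: "lorentz (y k) f = a * (c\<^sup>2) ^ k" for k
  proof -
    have "a - b k * (1 - c\<^sup>2) = a - a * ((1 - c\<^sup>2) * (\<Sum>i<k. (c\<^sup>2) ^ i))"
      unfolding b_def by (simp only: mult_ac)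
    also have "\<dots> = a * (c\<^sup>2) ^ k"
      unfolding one_diff_power_eq[symmetric] by (simp add: right_diff_distrib)
    finally show ?thesis by (simp add: y_def a_def[symmetric] ee fe power2_eq_square)
  qed
  have ye_eq: "lorentz (y k) e = 0" for k by (simp add: y_def x ee fe)
  have y: "y k \<in> future \<and> (\<forall>g\<in>walls P. lorentz (y k) g \<le> 0)" for k
  proof (induction k)
    case 0
    show ?case using xf x_le by (simp add: y_def b_def)
  next
    case (Suc k)
    define z where "z = y k - lorentz (y k) f *\<^sub>R f"
    have z: "z \<in> future" "\<And>g. g \<in> walls P \<Longrightarrow> lorentz z g \<le> 0"
      unfolding z_def using projection_nonpos[OF f, of "y k"] Suc by blast+
    have "y (Suc k) = z - lorentz z e *\<^sub>R e"
      by (simp add: z_def yf_eq ye_eq fe) (simp add: y_def b_def algebra_simps)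
    then show ?case using projection_nonpos[OF e z] by simp
  qed
  define y' where "y' = x - (a / (1 - c\<^sup>2)) *\<^sub>R (f - c *\<^sub>R e)"
  have "(\<lambda>k. \<Sum>i<k. (c\<^sup>2) ^ i) \<longlonglongrightarrow> 1 / (1 - c\<^sup>2)"
    using geometric_sums[of "c\<^sup>2"] c2 by (simp add: sums_def)
  then have "b \<longlonglongrightarrow> a * (1 / (1 - c\<^sup>2))" unfolding b_def by (intro tendsto_mult_left)
  then have "b \<longlonglongrightarrow> a / (1 - c\<^sup>2)" by simp
  then have lim: "y \<longlonglongrightarrow> y'" unfolding y_def y'_def by (intro tendsto_intros)
  have y'_le: "lorentz y' g \<le> 0" if g: "g \<in> walls P" for g
  proof (rule LIMSEQ_le_const2)
    show "(\<lambda>k. lorentz (y k) g) \<longlonglongrightarrow> lorentz y' g"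
      unfolding lorentz_inner by (intro tendsto_intros lim)
    show "\<exists>N. \<forall>n\<ge>N. lorentz (y n) g \<le> 0" using y g by blast
  qed
  have y'e: "lorentz y' e = 0" by (simp add: y'_def x ee fe)
  have y'f: "lorentz y' f = 0"
    using c2 by (simp add: y'_def ee fe a_def[symmetric] power2_eq_square[symmetric])
  have y'x: "lorentz x y' = - 1 - a\<^sup>2 / (1 - c\<^sup>2)"
    using x by (simp add: y'_def a_def[symmetric] P_iff hyp_future power2_eq_square)
  moreover have "a\<^sup>2 / (1 - c\<^sup>2) \<ge> 0" using c2 by simp
  ultimately have neg: "lorentz x y' < 0" by linarith
  \<comment> \<open>\<open>y'\<close> is orthogonal to \<open>e\<close> and \<open>f\<close> and
    differs from \<open>x\<close> by a combination of them. So the limit is timelike and not merely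
    causal.\<close>
  moreover have "lorentz y' y' = lorentz x y'"
  proof -
    have "lorentz y' y' = lorentz (x - (a / (1 - c\<^sup>2)) *\<^sub>R (f - c *\<^sub>R e)) y'" by (simp add: y'_def)
    also have "\<dots> = lorentz x y'"
      using y'e y'f by (simp add: lorentz_commute[of _ y'] del: lorentz_linear)
        (simp add: lorentz_commute[of _ y'])
    finally show ?thesis .
  qed
  ultimately have "y' \<in> future" by (intro future_timelike[OF xf]) linarith+
  then obtain d where d: "d > 0" "d *\<^sub>R y' \<in> P" 
    by (rule normalize_P[OF _ y'_le])
  then show False using disj[OF d(2)] y'e y'f by simp
qed

lemma reflection_system: "reflection_system (walls P)"
proof
  show "lorentz e e = 1" if "e \<in> walls P" for e using that by (rule wall_unit)
  show "lorentz e f \<le> - 1 \<or> (\<exists>m::nat. m \<ge> 2 \<and> lorentz e f = - cos (pi / real m))"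
    if ef: "e \<in> walls P" "f \<in> walls P" "e \<noteq> f" for e f
  proof (cases "\<exists>p\<in>P. lorentz p e = 0 \<and> lorentz p f = 0")
    case True
    then show ?thesis using intersecting_angle[OF ef] by metis
  next
    case False
    then show ?thesis using disjoint_faces[OF ef(1,2)] by blast
  qed
qed

end

sublocale coxeter \<subseteq> reflection_system "walls P"
  by (rule reflection_system)

subsection \<open>The tessellation by copies of the polyhedron\<close>

text \<open>The component of \<open>z\<close> orthogonal to the timelike \<open>x\<close> is
  spacelike or zero, which turns the usual inequality around.\<close>

lemma reverse_cauchy_schwarz:
  assumes "x \<in> future"
  shows "lorentz x x * lorentz z z \<le> (lorentz x z)\<^sup>2"
proof -
  have xx: "lorentz x x < 0" using assms by (simp add: future_iff)
  define w where "w = z - (lorentz x z / lorentz x x) *\<^sub>R x"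
  have "lorentz x w = 0" using xx by (simp add: w_def)
  then have "lorentz w w \<ge> 0" using future_orthogonal[OF assms, of w] by (cases "w = 0") auto
  moreover have "lorentz w w = lorentz z z - (lorentz x z)\<^sup>2 / lorentz x x"
    using xx by (simp add: w_def lorentz_commute[of z x] power2_eq_square field_simps)
  ultimately have "(lorentz x z)\<^sup>2 / lorentz x x \<le> lorentz z z" by simp
  then show ?thesis using xx by (simp add: neg_divide_le_eq mult.commute)
qed

text \<open>\<open>- lorentz x z\<close> is the hyperbolic cosine of a distance and
  \<open>- lorentz x e\<close> the hyperbolic sine of the signed distance from the hyperplane; a
  point beyond the hyperplane is no closer than the hyperplane. The proof compares the projections
  of \<open>x\<close> and \<open>z\<close> to it.\<close>

lemma separated_by_hyperplane:
  assumes e: "lorentz e e = 1" and x: "x \<in> hyp" and z: "z \<in> hyp"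
    and a: "lorentz x e \<le> - a" "0 \<le> a" and b: "0 \<le> lorentz z e"
  shows "lorentz x z \<le> - sqrt (1 + a\<^sup>2)"
proof -
  define c where "c = - lorentz x e"
  define b where "b = lorentz z e"
  have cb: "a \<le> c" "0 \<le> c" "0 \<le> b" using assms by (simp_all add: c_def b_def)
  have xf: "x \<in> future" "lorentz x x = - 1" "z \<in> future" "lorentz z z = - 1"
    using x z by (simp_all add: hyp_future)
  define x' where "x' = x + c *\<^sub>R e"
  define z' where "z' = z - b *\<^sub>R e"
  have ex: "lorentz x e = - c" "lorentz e x = - c" "lorentz z e = b" "lorentz e z = b"
    by (simp_all add: c_def b_def lorentz_commute)
  have x': "lorentz x' x' = - (1 + c\<^sup>2)" "lorentz x x' = - (1 + c\<^sup>2)"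
    and z': "lorentz z' z' = - (1 + b\<^sup>2)" "lorentz z z' = - (1 + b\<^sup>2)"
    and xz: "lorentz x z = lorentz x' z' - c * b"
    by (simp_all add: x'_def z'_def ex e xf power2_eq_square algebra_simps)
  have pos: "0 < 1 + c\<^sup>2" "0 < 1 + b\<^sup>2" by (simp_all add: add_pos_nonneg)
  have x'f: "x' \<in> future" by (rule future_timelike[OF xf(1)]) (use x' pos in linarith)+
  have z'f: "z' \<in> future" by (rule future_timelike[OF xf(3)]) (use z' pos in linarith)+
  have "1 + a\<^sup>2 \<le> 1 + c\<^sup>2" using cb a by (simp add: power_mono)
  also have "\<dots> \<le> (1 + c\<^sup>2) * (1 + b\<^sup>2)" using pos by simp
  also have "\<dots> \<le> (lorentz x' z')\<^sup>2"
    using reverse_cauchy_schwarz[OF x'f, of z'] unfolding x' z' minus_mult_minus .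
  finally have "sqrt (1 + a\<^sup>2) \<le> \<bar>lorentz x' z'\<bar>" using real_le_rsqrt real_sqrt_le_mono by fastforce
  moreover have "lorentz x' z' < 0" using future_lorentz[OF x'f z'f] .
  moreover have "0 \<le> c * b" using cb by simp
  ultimately show ?thesis unfolding xz by linarith
qed

text \<open>For \<open>x\<close> on the hyperboloid these are closed metric balls about
  \<open>x\<close>, or empty. The gap \<open>fst x - norm (snd x)\<close> bounds the time coordinate
  of \<open>y\<close>, and with it \<open>y\<close>.\<close>

lemma compact_hyp_lorentz_ge:
  fixes x :: "'n::finite mink"
  assumes x: "x \<in> future"
  shows "compact {y \<in> hyp. - r \<le> lorentz y x}"
proof (rule compact_eq_bounded_closed[THEN iffD2, OF conjI])
  have d: "fst x - norm (snd x) > 0" using x by (simp add: future_def)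
  show "bounded {y \<in> hyp. - r \<le> lorentz y x}"
  proof (rule boundedI)
    fix y assume y: "y \<in> {y \<in> hyp. - r \<le> lorentz y x}"
    then have yf: "norm (snd y) < fst y" by (simp add: hyp_future future_def)
    have "snd y \<bullet> snd x \<le> norm (snd y) * norm (snd x)" by (rule norm_cauchy_schwarz)
    also have "\<dots> \<le> fst y * norm (snd x)" using yf by (intro mult_right_mono) auto
    finally have "fst y * (fst x - norm (snd x)) \<le> r"
      using y by (simp add: lorentz_def algebra_simps)
    then have "fst y \<le> r / (fst x - norm (snd x))" using d by (simp add: pos_le_divide_eq)
    moreover have "norm y \<le> norm (fst y) + norm (snd y)"
      by (metis norm_Pair_le prod.collapse)
    moreover have "norm (fst y) = fst y" using yf norm_ge_zero[of "snd y"] by (simp del: norm_ge_zero)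
    ultimately show "norm y \<le> 2 * (r / (fst x - norm (snd x)))" using yf by linarith
  qed
  \<comment> \<open>On the hyperboloid the time coordinate never vanishes, so the strict condition
    can be replaced by a closed one.\<close>
  have fst_pos: "0 < fst y \<longleftrightarrow> 0 \<le> fst y" if "lorentz y y = - 1" for y :: "'n mink"
    using that by (auto simp: lorentz_def less_le) (metis inner_ge_zero not_one_le_zero neg_0_le_iff_le)
  then have "{y \<in> hyp. - r \<le> lorentz y x} =
      {y. lorentz y y = - 1} \<inter> {y. 0 \<le> fst y} \<inter> {y. - r \<le> lorentz y x}"
    by (auto simp: hyp_def)
  moreover have "closed \<dots>"
    by (intro closed_Int closed_Collect_eq closed_Collect_le continuous_intros)
  ultimately show "closed {y \<in> hyp. - r \<le> lorentz y x}" by simp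
qed

lemma infinite_distinct:
  assumes "infinite S"
  obtains p q where "p \<in> S" "q \<in> S" "p \<noteq> q"
proof -
  obtain p where "p \<in> S" using infinite_imp_nonempty[OF assms] by blast
  moreover obtain q where "q \<in> S - {p}"
    using infinite_imp_nonempty[OF infinite_remove[OF assms]] by blast
  ultimately show thesis using that by blast
qed

lemma finite_maximizer:
  fixes f :: "'a \<Rightarrow> 'b::linorder"
  assumes "finite S" "x \<in> S"
  obtains d where "d \<in> S" "\<forall>g\<in>S. f g \<le> f d"
proof -
  have "Max (f ` S) \<in> f ` S" using assms by (intro Max_in) auto
  then obtain d where "d \<in> S" "Max (f ` S) = f d" by (rule imageE)
  moreover have "f g \<le> Max (f ` S)" if "g \<in> S" for g using assms(1) that by simp
  ultimately show thesis using that by metis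
qed

section \<open>Action of the reflection group on the copies of \<open>P\<close>\<close>

context coxeter
begin

abbreviation "W \<equiv> word ` lists (walls P)"

lemma W_props:
  assumes "\<gamma> \<in> W"
  shows W_linear: "linear \<gamma>" and W_lorentz: "lorentz (\<gamma> x) (\<gamma> y) = lorentz x y"
    and W_hyp: "x \<in> hyp \<Longrightarrow> \<gamma> x \<in> hyp"
proof -
  obtain ws where ws: "ws \<in> lists (walls P)" "\<gamma> = word ws" using assms by blast
  then have "lorentz e e = 1" if "e \<in> set ws" for e
    using that wall_unit[of e] by (meson in_listsD)
  then show "linear \<gamma>" "lorentz (\<gamma> x) (\<gamma> y) = lorentz x y" "x \<in> hyp \<Longrightarrow> \<gamma> x \<in> hyp"
    unfolding ws(2) by (simp_all add: linear_word word_lorentz word_hyp)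
qed

lemma W_inverse:
  assumes "\<gamma> \<in> W"
  obtains \<gamma>' where "\<gamma>' \<in> W" "\<And>x. \<gamma>' (\<gamma> x) = x" "\<And>x. \<gamma> (\<gamma>' x) = x"
proof -
  obtain ws where ws: "ws \<in> lists (walls P)" "\<gamma> = word ws" using assms by blast
  then have "lorentz e e = 1" if "e \<in> set ws" for e
    using that wall_unit[of e] by (meson in_listsD)
  then have "word (rev ws) (word ws x) = x" "word (rev (rev ws)) (word (rev ws) x) = x" for x
    using word_rev[of ws] word_rev[of "rev ws"] by simp_all
  moreover have "word (rev ws) \<in> W" using ws by (intro imageI) auto
  ultimately show thesis using that ws(2) by simp
qed

lemma id_W: "id \<in> W"
  by (rule image_eqI[of _ _ "[]"]) simp_all

lemma reflection_W: "e \<in> walls P \<Longrightarrow> hyp_reflection e \<in> W"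
  by (rule reflection_word)

lemma W_comp: "\<gamma> \<in> W \<Longrightarrow> \<delta> \<in> W \<Longrightarrow> \<gamma> \<circ> \<delta> \<in> W"
  by (rule word_comp)

text \<open>\<open>s\<close> is the last letter of a shortest word. The sign theorem applies to the
  shortened element, and \<open>\<gamma> s\<close> is the negative of its root, so the hyperplane of
  \<open>\<gamma> s\<close> separates \<open>P\<close> from its copy under \<gamma>.\<close>

lemma descent:
  assumes "\<gamma> \<in> W" "\<gamma> \<noteq> id"
  obtains s where "s \<in> walls P" "\<gamma> \<circ> hyp_reflection s \<in> W"
    "word_length (walls P) (\<gamma> \<circ> hyp_reflection s) < word_length (walls P) \<gamma>"
    "\<And>x. x \<in> P \<Longrightarrow> lorentz x (\<gamma> s) \<ge> 0"
proof -
  obtain ws where ws: "ws \<in> lists (walls P)" "length ws = word_length (walls P) \<gamma>" "word ws = \<gamma>"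
    using assms(1) by (rule word_length_attained)
  then have "ws \<noteq> []" using assms(2) by auto
  then obtain us s where us: "ws = us @ [s]" by (metis rev_exhaust)
  then have s: "s \<in> walls P" and us_W: "us \<in> lists (walls P)" using ws by auto
  have \<gamma>: "\<gamma> = word us \<circ> hyp_reflection s" using ws us by (metis comp_id word_append word_simps)
  then have eq: "\<gamma> \<circ> hyp_reflection s = word us"
    using comp_reflection_cancel[OF unit[OF s]] by metis
  have lt: "word_length (walls P) (word us) < word_length (walls P) \<gamma>"
    using word_length_le[OF us_W] ws us by simp
  have "\<gamma> s = - word us s"
    using reflection_self[OF unit[OF s]] linear_neg[OF linear_word] by (simp add: \<gamma>)
  moreover have "lorentz x (word us s) \<le> 0" if "x \<in> P" for x
  proof (rule root_nonpos[OF _ imageI[OF us_W] s])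
    show "lorentz x e \<le> 0" if "e \<in> walls P" for e using that \<open>x \<in> P\<close> by (simp add: P_iff)
    show "word_length (walls P) (word us) \<le> word_length (walls P) (word us \<circ> hyp_reflection s)"
      using lt unfolding \<gamma> by simp
  qed
  ultimately show thesis using that[of s] s us_W lt eq by auto
qed

lemma W_interior:
  assumes "\<gamma> \<in> W" "\<And>e. e \<in> walls P \<Longrightarrow> lorentz x e < 0" "\<gamma> x \<in> P"
  shows "\<gamma> = id"
proof (rule ccontr)
  assume "\<gamma> \<noteq> id"
  with assms(1) obtain s where s: "s \<in> walls P" "\<And>x. x \<in> P \<Longrightarrow> lorentz x (\<gamma> s) \<ge> 0"
    by (rule descent) blast
  have "lorentz (\<gamma> x) (\<gamma> s) \<ge> 0" using s(2) assms(3) .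
  then show False using assms(2)[OF s(1)] W_lorentz[OF assms(1)] by simp
qed

text \<open>If \<open>\<gamma> p\<close> is in \<open>P\<close>, the separating hyperplane of a
  descent forces \<open>p\<close> onto the wall \<open>s\<close>, whose reflection fixes both
  \<open>p\<close> and \<open>v\<close> and can be stripped off. With \<open>v = p\<close> this says
  that \<open>P\<close> meets each orbit at most once.\<close>

lemma W_stabilizer:
  assumes "\<gamma> \<in> W" "p \<in> P" "\<gamma> p \<in> P" "\<And>e. e \<in> walls_at P p \<Longrightarrow> lorentz v e = 0"
  shows "\<gamma> v = v"
  using assms(1,3)
proof (induction "word_length (walls P) \<gamma>" arbitrary: \<gamma> rule: less_induct)
  case less
  show ?case
  proof (cases "\<gamma> = id")
    case False
    with less.prems(1) obtain s where s: "s \<in> walls P" "\<gamma> \<circ> hyp_reflection s \<in> W"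
      "word_length (walls P) (\<gamma> \<circ> hyp_reflection s) < word_length (walls P) \<gamma>"
      "\<And>x. x \<in> P \<Longrightarrow> lorentz x (\<gamma> s) \<ge> 0"
      by (rule descent) blast
    have "lorentz (\<gamma> p) (\<gamma> s) \<ge> 0" using s(4) less.prems(2) .
    then have "lorentz p s \<ge> 0" using W_lorentz[OF less.prems(1)] by simp
    then have ps: "lorentz p s = 0" using assms(2) s(1) by (fastforce simp: P_iff)
    then have "s \<in> walls_at P p" using s(1) by (simp add: walls_at_def)
    then have "lorentz v s = 0" by (rule assms(4))
    then have eq: "hyp_reflection s p = p" "hyp_reflection s v = v"
      using ps by (simp_all add: hyp_reflection_def)
    have "(\<gamma> \<circ> hyp_reflection s) v = v"
      using less.prems(2) by (intro less.hyps[OF s(3,2)]) (simp add: eq)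
    then show ?thesis by (simp add: eq)
  qed simp
qed

text \<open>An image of \<open>x0\<close> under a nontrivial element lies beyond some wall, while
  \<open>x0\<close> itself has depth at least \<open>b\<close> below every wall; so orbit points are
  uniformly apart.\<close>

lemma orbit_separated:
  obtains x0 a where "x0 \<in> P" "a > 1"
    "\<forall>\<gamma>\<in>W. \<forall>\<delta>\<in>W. \<gamma> \<noteq> \<delta> \<longrightarrow> lorentz (\<gamma> x0) (\<delta> x0) \<le> - a"
    "\<And>e. e \<in> walls P \<Longrightarrow> lorentz x0 e < 0"
proof -
  obtain x0 where x0: "x0 \<in> P" "\<And>e. e \<in> walls P \<Longrightarrow> lorentz x0 e < 0"
    by (rule interior_point) blast
  \<comment> \<open>The inserted 1 keeps the minimum defined and positive if there are no
    walls.\<close>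
  define b where "b = Min (insert 1 ((\<lambda>e. - lorentz x0 e) ` walls P))"
  have "b > 0" unfolding b_def using finite_walls x0(2) by (subst Min_gr_iff) auto
  have b: "lorentz x0 e \<le> - b" if "e \<in> walls P" for e
  proof -
    have "b \<le> - lorentz x0 e" unfolding b_def using finite_walls that by (intro Min_le) auto
    then show ?thesis by simp
  qed
  define a where "a = sqrt (1 + b\<^sup>2)"
  have "a > 1" using \<open>b > 0\<close> by (simp add: a_def)
  moreover have "lorentz (\<gamma> x0) (\<delta> x0) \<le> - a" if "\<gamma> \<in> W" "\<delta> \<in> W" "\<gamma> \<noteq> \<delta>" for \<gamma> \<delta>
  proof -
    obtain \<gamma>' where \<gamma>': "\<gamma>' \<in> W" "\<And>x. \<gamma>' (\<gamma> x) = x" "\<And>x. \<gamma> (\<gamma>' x) = x"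
      by (rule W_inverse[OF \<open>\<gamma> \<in> W\<close>]) blast
    have comp: "\<gamma>' \<circ> \<delta> \<in> W" using \<gamma>'(1) that(2) by (rule W_comp)
    have "\<gamma>' \<circ> \<delta> \<noteq> id" using \<gamma>'(3) that(3) by (metis comp_apply ext id_apply)
    then have "(\<gamma>' \<circ> \<delta>) x0 \<notin> P" using W_interior[OF comp x0(2)] by blast
    moreover have hyp: "(\<gamma>' \<circ> \<delta>) x0 \<in> hyp" using W_hyp[OF comp] x0(1) by (simp add: P_iff)
    ultimately obtain e where e: "e \<in> walls P" "lorentz ((\<gamma>' \<circ> \<delta>) x0) e > 0"
      by (force simp: P_iff not_le)
    have "lorentz (\<gamma> x0) (\<delta> x0) = lorentz (\<gamma>' (\<gamma> x0)) (\<gamma>' (\<delta> x0))"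
      using W_lorentz[OF \<gamma>'(1)] by simp
    also have "\<dots> = lorentz x0 ((\<gamma>' \<circ> \<delta>) x0)" using \<gamma>'(2) by simp
    also have "\<dots> \<le> - a" unfolding a_def
      using x0(1) hyp b[OF e(1)] \<open>b > 0\<close> e(2)
      by (intro separated_by_hyperplane[OF wall_unit[OF e(1)]]) (simp_all add: P_iff)
    finally show ?thesis .
  qed
  ultimately show thesis using that x0 by blast
qed

text \<open>Infinitely many orbit points in a compact set would accumulate at some \<open>y\<close>.
  Near \<open>(y, y)\<close> products are close to -1, hence above \<open>- a\<close>, whereas
  distinct orbit points have product at most \<open>- a\<close>.\<close>

lemma orbit_locally_finite:
  assumes "x0 \<in> P" "a > 1"
    and sep: "\<forall>\<gamma>\<in>W. \<forall>\<delta>\<in>W. \<gamma> \<noteq> \<delta> \<longrightarrow> lorentz (\<gamma> x0) (\<delta> x0) \<le> - a"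
    and x: "x \<in> future"
  shows "finite {\<gamma> \<in> W. - r \<le> lorentz (\<gamma> x0) x}"
proof (rule ccontr)
  let ?S = "{\<gamma> \<in> W. - r \<le> lorentz (\<gamma> x0) x}"
  let ?K = "{y \<in> hyp. - r \<le> lorentz y x}"
  let ?O = "(\<lambda>\<gamma>. \<gamma> x0) ` ?S"
  assume inf: "infinite ?S"
  have x0: "x0 \<in> hyp" "lorentz x0 x0 = - 1" using assms(1) by (simp_all add: P_iff hyp_future)
  have "inj_on (\<lambda>\<gamma>. \<gamma> x0) ?S"
  proof (rule inj_onI, rule ccontr)
    fix \<gamma> \<delta> assume gd: "\<gamma> \<in> ?S" "\<delta> \<in> ?S" "\<gamma> x0 = \<delta> x0" "\<gamma> \<noteq> \<delta>"
    then have "lorentz (\<gamma> x0) (\<delta> x0) \<le> - a" using sep by blast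
    then have "lorentz (\<gamma> x0) (\<gamma> x0) \<le> - a" by (simp only: gd(3))
    then show False using gd(1) W_lorentz[of \<gamma>] x0 \<open>a > 1\<close> by simp
  qed
  then have "infinite ?O" using inf by (simp add: finite_image_iff)
  moreover have "?O \<subseteq> ?K" using W_hyp x0 by blast
  ultimately have "\<exists>y\<in>?K. y islimpt ?O"
    by (rule Heine_Borel_imp_Bolzano_Weierstrass[OF compact_hyp_lorentz_ge[OF x]])
  then obtain y where y: "y \<in> ?K" "y islimpt ?O" by (rule bexE)
  have "lorentz y y = - 1" using y(1) by (simp add: hyp_future)
  define V where "V = {p :: 'n mink \<times> 'n mink. - a < lorentz (fst p) (snd p)}"
  have "open V" unfolding V_def by (intro open_Collect_less continuous_intros)
  moreover have "(y, y) \<in> V" using \<open>lorentz y y = - 1\<close> \<open>a > 1\<close> by (simp add: V_def)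
  ultimately obtain A B where AB: "open A" "open B" "y \<in> A" "y \<in> B" "A \<times> B \<subseteq> V"
    by (metis open_prod_elim mem_Sigma_iff)
  have "open (A \<inter> B)" "y \<in> A \<inter> B" using AB by auto
  then have "infinite ((A \<inter> B) \<inter> ?O)"
    using y(2) unfolding islimpt_eq_acc_point by blast
  then obtain p q where pq: "p \<in> (A \<inter> B) \<inter> ?O" "q \<in> (A \<inter> B) \<inter> ?O" "p \<noteq> q"
    by (rule infinite_distinct)
  then obtain \<gamma> \<delta> where gd: "\<gamma> \<in> W" "\<delta> \<in> W" "p = \<gamma> x0" "q = \<delta> x0" by blast
  then have "\<gamma> \<noteq> \<delta>" using pq(3) by blast
  then have "lorentz p q \<le> - a" using sep gd by blast
  moreover have "(p, q) \<in> V" using pq AB(5) by blast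
  ultimately show False by (simp add: V_def)
qed

lemma finite_stabilizer:
  assumes "v \<in> hyp"
  shows "finite {\<gamma> \<in> W. \<gamma> v = v}"
proof -
  obtain x0 a where x0: "x0 \<in> P" "a > 1"
    "\<forall>\<gamma>\<in>W. \<forall>\<delta>\<in>W. \<gamma> \<noteq> \<delta> \<longrightarrow> lorentz (\<gamma> x0) (\<delta> x0) \<le> - a"
    by (rule orbit_separated) blast
  have "v \<in> future" using assms by (simp add: hyp_future)
  then have "finite {\<gamma> \<in> W. - (- lorentz x0 v) \<le> lorentz (\<gamma> x0) v}"
    by (rule orbit_locally_finite[OF x0])
  moreover have "lorentz (\<gamma> x0) v = lorentz x0 v" if "\<gamma> \<in> W" "\<gamma> v = v" for \<gamma>
    using W_lorentz[OF that(1), of x0 v] that(2) by simp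
  then have "{\<gamma> \<in> W. \<gamma> v = v} \<subseteq> {\<gamma> \<in> W. - (- lorentz x0 v) \<le> lorentz (\<gamma> x0) v}"
    by (intro Collect_mono impI conjI) simp_all
  ultimately show ?thesis by (rule finite_subset[rotated])
qed

text \<open>The copy of \<open>P\<close> containing \<open>x\<close> is the one whose base point in the orbit of \<open>x0\<close> is closest to \<open>x\<close>.\<close>

lemma W_covers:
  assumes "x \<in> hyp"
  obtains \<gamma> where "\<gamma> \<in> W" "\<gamma> x \<in> P"
proof -
  obtain x0 a where x0: "x0 \<in> P" "a > 1"
    "\<forall>\<gamma>\<in>W. \<forall>\<delta>\<in>W. \<gamma> \<noteq> \<delta> \<longrightarrow> lorentz (\<gamma> x0) (\<delta> x0) \<le> - a"
    and strict: "\<And>e. e \<in> walls P \<Longrightarrow> lorentz x0 e < 0"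
    by (rule orbit_separated) blast
  let ?f = "\<lambda>\<gamma>. lorentz (\<gamma> x0) x"
  let ?S = "{\<gamma> \<in> W. - (- ?f id) \<le> ?f \<gamma>}"
  have "x \<in> future" using assms by (simp add: hyp_future)
  then have fin: "finite ?S" by (rule orbit_locally_finite[OF x0])
  have "id \<in> ?S" using id_W by simp
  then obtain \<delta> where \<delta>: "\<delta> \<in> ?S" "\<forall>\<gamma>\<in>?S. ?f \<gamma> \<le> ?f \<delta>"
    by (rule finite_maximizer[OF fin])
  have \<delta>W: "\<delta> \<in> W" using \<delta>(1) by simp
  have mx: "?f \<gamma> \<le> ?f \<delta>" if "\<gamma> \<in> W" for \<gamma>
  proof (cases "\<gamma> \<in> ?S")
    case True
    then show ?thesis using \<delta>(2) by blast
  next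
    case False
    then have "?f \<gamma> < ?f id" using that by simp
    also have "\<dots> \<le> ?f \<delta>" using \<delta>(1) by simp
    finally show ?thesis by simp
  qed
  obtain \<gamma> where \<gamma>: "\<gamma> \<in> W" "\<And>x. \<gamma> (\<delta> x) = x" "\<And>x. \<delta> (\<gamma> x) = x"
    by (rule W_inverse[OF \<delta>W]) blast
  have "lorentz (\<gamma> x) e \<le> 0" if e: "e \<in> walls P" for e
  proof -
    \<comment> \<open>The mirror image of the closest base point is not closer to \<open>x\<close>,
      so \<open>\<gamma> x\<close> lies on the side of \<open>e\<close> that contains
      \<open>x0\<close>.\<close>
    have "?f (\<delta> \<circ> hyp_reflection e) \<le> ?f \<delta>"
      using \<delta>W e by (intro mx W_comp reflection_W)
    then have "lorentz (\<delta> (hyp_reflection e x0)) (\<delta> (\<gamma> x)) \<le> lorentz (\<delta> x0) (\<delta> (\<gamma> x))"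
      using \<gamma>(3) by simp
    then have "lorentz (hyp_reflection e x0) (\<gamma> x) \<le> lorentz x0 (\<gamma> x)"
      unfolding W_lorentz[OF \<delta>W] .
    then have "lorentz x0 e * lorentz e (\<gamma> x) \<ge> 0" by (simp add: hyp_reflection_def)
    then show ?thesis using strict[OF e] by (simp add: zero_le_mult_iff lorentz_commute)
  qed
  then have "\<gamma> x \<in> P" using W_hyp[OF \<gamma>(1) assms] by (simp add: P_iff)
  then show thesis using that \<gamma>(1) by blast
qed

end

subsection \<open>Finite volume\<close>

text \<open>Near the ideal point \<open>(1, \<omega>)\<close> all inequalities stay strict, so the
  region lies over Euclidean balls about \<open>R k *\<^sub>R \<omega>\<close> with radius
  proportional to \<open>R k\<close>. They are disjoint, and each contributes at least the fixed
  volume \<open>V\<close>.\<close>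

lemma hyp_volume_infinite:
  fixes \<omega> :: "real ^ 'n::finite"
  assumes fin: "finite N" and \<omega>: "norm \<omega> = 1" and neg: "\<And>g. g \<in> N \<Longrightarrow> lorentz (1, \<omega>) g < 0"
  shows "hyp_volume {x \<in> hyp. \<forall>g\<in>N. lorentz x g \<le> 0} = \<infinity>"
proof -
  let ?S = "{x \<in> hyp. \<forall>g\<in>N. lorentz x g \<le> 0}"
  let ?n = "CARD('n)"
  define U where "U = (\<Inter>g\<in>N. {y. lorentz y g < 0})"
  have "open U" unfolding U_def
    using fin by (intro open_INT ballI open_Collect_less) (auto intro!: continuous_intros)
  moreover have "(1, \<omega>) \<in> U" using neg by (simp add: U_def)
  ultimately obtain \<epsilon> where \<epsilon>: "\<epsilon> > 0" "ball (1, \<omega>) \<epsilon> \<subseteq> U"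
    using openE by blast
  \<comment> \<open>After division by \<open>R k\<close>, a point over \<open>B k\<close> is off by
    less than \<open>2 \<delta>\<close> in time and \<delta> in space, hence
    \<open>3 \<delta> \<le> \<epsilon>\<close>. The bound \<open>1 / 4\<close> keeps balls with
    doubling centres apart.\<close>
  define \<delta> where "\<delta> = min (\<epsilon> / 3) (1 / 4)"
  have \<delta>: "0 < \<delta>" "\<delta> \<le> 1 / 4" "3 * \<delta> \<le> \<epsilon>" using \<epsilon> by (auto simp: \<delta>_def min_def)
  \<comment> \<open>The time coordinate exceeds \<open>norm x\<close> by at most 1; radii from
    \<open>2 ^ K\<close> on make this error relatively smaller than \<delta>.\<close>
  obtain K where K: "(1 / 2) ^ K < \<delta>" using real_arch_pow_inv[of \<delta> "1 / 2"] \<delta> by auto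
  define R where "R k = (2::real) ^ (k + K)" for k
  have R1: "1 \<le> R k" and R\<delta>: "1 / R k < \<delta>" for k
  proof -
    show "1 \<le> R k" by (simp add: R_def)
    have "1 / R k \<le> 1 / 2 ^ K" unfolding R_def by (intro divide_left_mono) (auto simp: power_increasing)
    also have "\<dots> < \<delta>" using K by (simp add: power_one_over)
    finally show "1 / R k < \<delta>" .
  qed
  have R2: "2 * R k \<le> R l" if "k < l" for k l
    using that power_increasing[of "Suc (k + K)" "l + K" "2::real"] by (simp add: R_def)
  define B where "B k = ball (R k *\<^sub>R \<omega>) (R k * \<delta>)" for k
  have B_norm: "R k * (1 - \<delta>) < norm x" "norm x < R k * (1 + \<delta>)" if "x \<in> B k" for k x
  proof -
    have nR: "norm (R k *\<^sub>R \<omega>) = R k" using \<omega> R1[of k] by simp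
    have "norm (R k *\<^sub>R \<omega> - x) < R k * \<delta>" using that by (simp add: B_def dist_norm)
    then show "R k * (1 - \<delta>) < norm x" "norm x < R k * (1 + \<delta>)"
      using norm_triangle_ineq2[of "R k *\<^sub>R \<omega>" x] norm_triangle_ineq2[of x "R k *\<^sub>R \<omega>"]
      unfolding nR norm_minus_commute[of x] by (simp_all add: algebra_simps)
  qed
  have disj: "k = l" if "x \<in> B k" "x \<in> B l" for k l x
  proof -
    have False if kl: "k < l" "x \<in> B k" "x \<in> B l" for k l
    proof -
      have "2 * R k * (1 - \<delta>) \<le> R l * (1 - \<delta>)" using R2[OF kl(1)] \<delta> by (intro mult_right_mono) auto
      also have "\<dots> < R k * (1 + \<delta>)" using B_norm(1)[OF kl(3)] B_norm(2)[OF kl(2)] by simp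
      finally have "R k * (2 * (1 - \<delta>)) < R k * (1 + \<delta>)" by (simp add: mult_ac)
      then have "2 * (1 - \<delta>) < 1 + \<delta>" using R1[of k] by (simp add: mult_less_cancel_left)
      then show False using \<delta> by simp
    qed
    from this[of k l] this[of l k] that show ?thesis by (metis nat_neq_iff)
  qed
  have inS: "(sqrt (1 + (norm x)\<^sup>2), x) \<in> ?S" and low: "1 / (3 * R k) \<le> 1 / sqrt (1 + (norm x)\<^sup>2)"
    if x: "x \<in> B k" for k x
  proof -
    let ?t = "sqrt (1 + (norm x)\<^sup>2)"
    have t0: "0 < ?t" by (simp add: add_pos_nonneg)
    have t1: "norm x \<le> ?t" by (rule real_le_rsqrt) simp
    have t2: "?t \<le> 1 + norm x" by (rule real_le_lsqrt) (simp_all add: power2_sum)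
    have R0: "0 < R k" using R1[of k] by simp
    define y where "y = (1 / R k) *\<^sub>R (?t, x)"
    have "?t \<le> R k * (1 + \<delta> + 1 / R k)" using t2 B_norm(2)[OF x] R0 by (simp add: algebra_simps)
    moreover have "R k * (1 - \<delta>) \<le> ?t" using t1 B_norm(1)[OF x] by simp
    ultimately have "fst y \<le> 1 + \<delta> + 1 / R k" "1 - \<delta> \<le> fst y"
      using R0 by (simp_all add: y_def pos_divide_le_eq pos_le_divide_eq mult.commute)
    then have d1: "dist 1 (fst y) < 2 * \<delta>" using R\<delta>[of k] \<delta> by (simp add: dist_real_def abs_if)
    have "\<omega> - snd y = (1 / R k) *\<^sub>R (R k *\<^sub>R \<omega> - x)" using R0 by (simp add: y_def algebra_simps)
    then have "dist \<omega> (snd y) = norm (R k *\<^sub>R \<omega> - x) / R k" using R0 by (simp add: dist_norm)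
    also have "\<dots> < \<delta>" using x R0 by (simp add: B_def dist_norm pos_divide_less_eq mult.commute)
    finally have d2: "dist \<omega> (snd y) < \<delta>" .
    have "dist (1, \<omega>) y \<le> dist 1 (fst y) + dist \<omega> (snd y)"
      by (cases y) (simp add: dist_Pair_Pair sqrt_sum_squares_le_sum)
    then have "y \<in> ball (1, \<omega>) \<epsilon>" using d1 d2 \<delta> by simp
    then have "y \<in> U" using \<epsilon> by blast
    have "lorentz (?t, x) g \<le> 0" if "g \<in> N" for g
    proof -
      have "lorentz y g < 0" using \<open>y \<in> U\<close> that by (simp add: U_def)
      then have "1 / R k * lorentz (?t, x) g < 0" unfolding y_def lorentz_linear(7) .
      then show ?thesis using R0 by (simp add: divide_less_0_iff)
    qed
    moreover have "(?t, x) \<in> hyp"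
      using t0 by (simp add: hyp_def lorentz_def dot_square_norm add_nonneg_nonneg flip: power2_eq_square)
    ultimately show "(?t, x) \<in> ?S" by simp
    have "?t \<le> 1 + R k * (1 + \<delta>)" using t2 B_norm(2)[OF x] by simp
    also have "\<dots> \<le> R k + R k * 2" using R1[of k] \<delta> by (intro add_mono mult_left_mono) auto
    finally show "1 / (3 * R k) \<le> 1 / ?t" using t0 by (intro frac_le) simp_all
  qed
  define V where "V = unit_ball_vol (real ?n) * \<delta> ^ ?n / 3"
  have "V > 0" using \<delta> by (simp add: V_def)
  have bound: "ennreal (real m * V) \<le> hyp_volume ?S" for m
  proof -
    let ?g = "\<lambda>x. \<Sum>k<m. ennreal (1 / (3 * R k)) * indicator (B k) x"
    have "V \<le> 1 / (3 * R k) * (unit_ball_vol (real ?n) * (R k * \<delta>) ^ ?n)" for k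
    proof -
      have "R k \<le> R k ^ ?n" using R1[of k] by (intro self_le_power) auto
      then have "V * R k \<le> V * R k ^ ?n" using \<open>V > 0\<close> by simp
      then show ?thesis using R1[of k] by (simp add: V_def power_mult_distrib field_simps)
    qed
    note V_le = this
    have "ennreal V \<le> ennreal (1 / (3 * R k)) * emeasure lborel (B k)" for k
    proof -
      have "0 \<le> R k * \<delta>" "0 \<le> 1 / (3 * R k)" using R1[of k] \<delta> by simp_all
      then have "emeasure lborel (B k) = ennreal (unit_ball_vol (real ?n) * (R k * \<delta>) ^ ?n)"
        unfolding B_def by (subst emeasure_ball) simp_all
      then have "ennreal (1 / (3 * R k)) * emeasure lborel (B k) =
          ennreal (1 / (3 * R k) * (unit_ball_vol (real ?n) * (R k * \<delta>) ^ ?n))"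
        using \<open>0 \<le> 1 / (3 * R k)\<close> by (simp only: ennreal_mult')
      then show ?thesis using ennreal_leI[OF V_le] by metis
    qed
    then have "(\<Sum>k<m. ennreal V) \<le> (\<Sum>k<m. ennreal (1 / (3 * R k)) * emeasure lborel (B k))"
      by (intro sum_mono)
    also have "\<dots> = (\<integral>\<^sup>+ x. ?g x \<partial>lborel)"
    proof (subst nn_integral_sum)
      show "(\<lambda>x. ennreal (1 / (3 * R k)) * indicator (B k) x) \<in> borel_measurable lborel" for k
        by (intro borel_measurable_times_ennreal borel_measurable_const borel_measurable_indicator)
          (simp add: B_def)
    qed (simp_all add: B_def nn_integral_cmult_indicator)
    also have "\<dots> \<le> hyp_volume ?S"
      unfolding hyp_volume_def
    proof (rule nn_integral_mono)
      fix x :: "real ^ 'n"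
      let ?h = "indicator ?S (sqrt (1 + (norm x)\<^sup>2), x) * ennreal (1 / sqrt (1 + (norm x)\<^sup>2))"
      show "?g x \<le> ?h"
      proof (cases "\<exists>k<m. x \<in> B k")
        case True
        then obtain k where k: "k < m" "x \<in> B k" by blast
        have "indicator (B l) x = (if l = k then 1 else 0 :: ennreal)" for l
          using disj[OF k(2), of l] k(2) by (cases "x \<in> B l") auto
        then have "?g x = (\<Sum>l<m. if l = k then ennreal (1 / (3 * R k)) else 0)"
          by (intro sum.cong) simp_all
        also have "\<dots> = ennreal (1 / (3 * R k))" using k(1) by simp
        also have "\<dots> \<le> ennreal (1 / sqrt (1 + (norm x)\<^sup>2))" using low[OF k(2)] by (rule ennreal_leI)
        also have "\<dots> = ?h" using inS[OF k(2)] by (simp only: indicator_simps mult_1)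
        finally show ?thesis .
      next
        case False
        then have "?g x = 0" by (intro sum.neutral) (auto simp: indicator_def)
        then show ?thesis by simp
      qed
    qed
    finally show ?thesis using \<open>V > 0\<close> by (simp add: ennreal_mult ennreal_of_nat_eq_real_of_nat)
  qed
  show ?thesis
  proof (rule ccontr)
    assume "hyp_volume ?S \<noteq> \<infinity>"
    then obtain r where r: "r \<ge> 0" "hyp_volume ?S = ennreal r"
      by (cases "hyp_volume ?S") auto
    obtain m where "r < real m * V" using reals_Archimedean3[OF \<open>V > 0\<close>] by blast
    then show False using bound[of m] r \<open>V > 0\<close> by (simp add: ennreal_le_iff2)
  qed
qed

context coxeter
begin

text \<open>If \<open>x\<close> were outside the closed cone, the segment from an interior point
  would cross the light cone before reaching \<open>x\<close>, where all inequalities are still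
  strict. That gives an ideal point around which \<open>P\<close> has infinite volume.\<close>

lemma finite_volume_causal:
  assumes vol: "hyp_volume P < \<infinity>" and x: "\<And>g. g \<in> walls P \<Longrightarrow> lorentz x g \<le> 0"
  shows "norm (snd x) \<le> fst x"
proof (rule ccontr)
  assume neg: "\<not> ?thesis"
  obtain x0 where x0: "x0 \<in> P" "\<And>e. e \<in> walls P \<Longrightarrow> lorentz x0 e < 0"
    by (rule interior_point) blast
  define y where "y t = (1 - t) *\<^sub>R x0 + t *\<^sub>R x" for t
  define f where "f t = norm (snd (y t)) - fst (y t)" for t
  have "f 0 \<le> 0" using P_future[OF x0(1)] by (simp add: f_def y_def future_def)
  moreover have f1: "0 \<le> f 1" "f 1 \<noteq> 0" using neg by (simp_all add: f_def y_def)
  moreover have "continuous_on {0..1} f" unfolding f_def y_def by (intro continuous_intros)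
  ultimately obtain t where t: "0 \<le> t" "t \<le> 1" "f t = 0"
    using IVT'[of f 0 0 1] by auto
  have "t \<noteq> 1" using t f1 by auto
  then have t1: "t < 1" using t by simp
  have y_neg: "lorentz (y t) g < 0" if "g \<in> walls P" for g
  proof -
    have "(1 - t) * lorentz x0 g < 0" using t1 x0(2)[OF that] by (simp add: mult_pos_neg)
    moreover have "t * lorentz x g \<le> 0" using t x[OF that] by (simp add: mult_nonneg_nonpos)
    ultimately show ?thesis by (simp add: y_def)
  qed
  obtain \<omega> :: "real ^ 'n" where "norm \<omega> = 1" "\<And>g. g \<in> walls P \<Longrightarrow> lorentz (1, \<omega>) g < 0"
  \<comment> \<open>The crossing may happen at the origin. No strict inequality holds there, so
    there are no walls and any direction will do.\<close>
  proof (cases "y t = 0")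
    case True
    then have no_walls: "g \<notin> walls P" for g using y_neg[of g] by auto
    obtain \<omega> :: "real ^ 'n" where "norm \<omega> = 1" using vector_choose_size[of 1] by auto
    then show thesis using that no_walls by blast
  next
    case False
    have eq: "norm (snd (y t)) = fst (y t)" using t(3) by (simp add: f_def)
    have "fst (y t) \<noteq> 0" using False eq by (metis norm_eq_zero prod_eqI fst_zero snd_zero)
    then have pos: "fst (y t) > 0" using eq norm_ge_zero[of "snd (y t)"] by linarith
    let ?\<omega> = "(1 / fst (y t)) *\<^sub>R snd (y t)"
    have "(1, ?\<omega>) = (1 / fst (y t)) *\<^sub>R y t" using pos by (intro prod_eqI) simp_all
    moreover have "norm ?\<omega> = 1" using pos eq by simp
    ultimately show thesis
      using that[of ?\<omega>] y_neg pos by (simp add: divide_less_0_iff)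
  qed
  then have "hyp_volume {x \<in> hyp. \<forall>g\<in>walls P. lorentz x g \<le> 0} = \<infinity>"
    by (intro hyp_volume_infinite finite_walls)
  moreover have "P = {x \<in> hyp. \<forall>g\<in>walls P. lorentz x g \<le> 0}" using P_iff by blast
  ultimately show False using vol by simp
qed

end

subsection \<open>Vertices\<close>

lemma ideal_boundary_iff: "v \<in> ideal_boundary \<longleftrightarrow> fst v = 1 \<and> norm (snd v) = 1"
proof -
  have "(norm (snd v))\<^sup>2 = 1 \<longleftrightarrow> norm (snd v) = 1"
    using power2_eq_1_iff[of "norm (snd v)"] norm_ge_zero[of "snd v"] by linarith
  then show ?thesis by (auto simp: ideal_boundary_def lorentz_self)
qed

lemma closure_klein:
  assumes y: "\<And>n. y n \<in> klein ` S" and lim: "y \<longlonglongrightarrow> v"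
  shows "v \<in> closure (klein ` S)"
  using assms by (auto simp: closure_sequential)

lemma klein_scale: "c \<noteq> 0 \<Longrightarrow> klein (c *\<^sub>R x) = klein x"
  by (simp add: klein_def)

text \<open>As \<open>v\<close> is null, adding \<open>t v\<close> changes the self-product by
  \<open>- 2 t c\<close> and no product with \<open>v\<close>. So the slice
  \<open>lorentz y v = - c\<close> modulo \<open>v\<close> is a linear model of the Euclidean
  horosphere.\<close>

lemma horosphere_meets_line:
  assumes v: "v \<in> ideal_boundary" and c: "c > 0" and y: "lorentz y v = - c"
  obtains t where "y + t *\<^sub>R v \<in> hyp" "lorentz (y + t *\<^sub>R v) v = - c"
proof -
  define t where "t = (1 + lorentz y y) / (2 * c)"
  have vv: "lorentz v v = 0" using v by (simp add: ideal_boundary_def)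
  have yy: "lorentz (y + t *\<^sub>R v) (y + t *\<^sub>R v) = - 1"
    using c by (simp add: vv y lorentz_commute[of v y] t_def field_simps)
  moreover have yv: "lorentz (y + t *\<^sub>R v) v = - c" by (simp add: vv y)
  moreover have "y + t *\<^sub>R v \<in> future"
  proof (rule future_timelike_causal)
    show "norm (snd v) \<le> fst v" "v \<noteq> 0" using v by (auto simp: ideal_boundary_iff)
    show "lorentz (y + t *\<^sub>R v) (y + t *\<^sub>R v) < 0" "lorentz (y + t *\<^sub>R v) v < 0"
      unfolding yy yv using c by simp_all
  qed
  ultimately show thesis using that by (simp add: hyp_future)
qed

context coxeter
begin

lemma finite_walls_at: "finite (walls_at P x)"
  using finite_walls by (simp add: walls_at_def)

text \<open>Enlarging wall sets step by step is replaced by one choice of a point with the largest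
  number of incident walls.\<close>

lemma maximal_walls_at:
  assumes "Q x"
  obtains y where "Q y" "\<And>z. Q z \<Longrightarrow> \<not> walls_at P y \<subset> walls_at P z"
proof -
  have "card (walls_at P y) < Suc (card (walls P))" for y
    using card_mono[OF finite_walls, of "walls_at P y"] by (auto simp: walls_at_def)
  then obtain y where "Q y" "\<And>z. Q z \<Longrightarrow> card (walls_at P z) \<le> card (walls_at P y)"
    using ex_has_greatest_nat[of Q x "\<lambda>y. card (walls_at P y)"] assms by metis
  moreover have "card (walls_at P y) < card (walls_at P z)" if "walls_at P y \<subset> walls_at P z" for y z
    using psubset_card_mono[OF finite_walls_at that] .
  ultimately show thesis using that by (meson not_le)
qed

end

section \<open>From a point of the polyhedron to a vertex\<close>

locale finite_volume_coxeter = coxeter +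
  assumes volume: "hyp_volume P < \<infinity>"
begin

lemma causal: "(\<And>g. g \<in> walls P \<Longrightarrow> lorentz x g \<le> 0) \<Longrightarrow> norm (snd x) \<le> fst x"
  by (rule finite_volume_causal[OF volume])

text \<open>In the slice \<open>fst v = 1\<close> the cone over \<open>P\<close> is a polytope,
  bounded since it lies in the light cone, and \<open>v\<close> is a vertex of its smallest face
  containing the ray of \<open>p\<close>. The last conclusion says that the walls at
  \<open>v\<close> meet in the line of \<open>v\<close> only.\<close>

lemma vertex_direction:
  assumes p: "p \<in> P"
  obtains v where "fst v = 1" "\<forall>g\<in>walls P. lorentz v g \<le> 0" "walls_at P p \<subseteq> walls_at P v"
    "\<forall>x. (\<forall>e\<in>walls_at P v. lorentz x e = 0) \<longrightarrow> x = fst x *\<^sub>R v"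
proof -
  define Q where "Q v \<longleftrightarrow> fst v = 1 \<and> (\<forall>g\<in>walls P. lorentz v g \<le> 0) \<and> walls_at P p \<subseteq> walls_at P v"
    for v
  have fp: "fst p > 0" using P_future[OF p] by (simp add: future_iff)
  have "Q ((1 / fst p) *\<^sub>R p)"
    using fp p by (auto simp: Q_def walls_at_def P_iff divide_le_0_iff)
  then obtain v where v: "Q v" and mx: "\<And>z. Q z \<Longrightarrow> \<not> walls_at P v \<subset> walls_at P z"
    by (rule maximal_walls_at) blast
  have v1: "fst v = 1" and v_le: "\<And>g. g \<in> walls P \<Longrightarrow> lorentz v g \<le> 0"
    and pv: "walls_at P p \<subseteq> walls_at P v" using v by (simp_all add: Q_def)
  have "x = fst x *\<^sub>R v" if x: "\<forall>e\<in>walls_at P v. lorentz x e = 0" for x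
  proof (rule ccontr)
    assume ne: "x \<noteq> fst x *\<^sub>R v"
    define d where "d = x - fst x *\<^sub>R v"
    have d0: "d \<noteq> 0" "fst d = 0" using ne v1 by (simp_all add: d_def)
    have d_tight: "lorentz d e = 0" if "e \<in> walls_at P v" for e
      using x that by (simp add: d_def walls_at_def)
    \<comment> \<open>Otherwise \<open>d\<close> would be causal with time coordinate 0, hence zero:
      the polytope contains no ray.\<close>
    have "\<exists>h\<in>walls P. lorentz d h > 0"
    proof (rule ccontr)
      assume "\<not> ?thesis"
      then have "norm (snd d) \<le> fst d" by (intro causal) (simp add: not_less)
      then show False using d0 by (metis norm_le_zero_iff prod_eqI fst_zero snd_zero)
    qed
    then obtain h where h: "h \<in> walls P" "lorentz d h > 0" by blast
    obtain s g where sg: "s \<ge> 0" "g \<in> walls P" "lorentz d g > 0" "lorentz (v + s *\<^sub>R d) g = 0"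
      "\<forall>g\<in>walls P. lorentz (v + s *\<^sub>R d) g \<le> 0"
      by (rule ray_exit[OF finite_walls v_le h])
    have sub: "walls_at P v \<subseteq> walls_at P (v + s *\<^sub>R d)"
      using d_tight by (auto simp: walls_at_def)
    then have "Q (v + s *\<^sub>R d)"
      using v1 d0 sg(5) pv by (simp add: Q_def del: lorentz_linear)
    moreover have "g \<in> walls_at P (v + s *\<^sub>R d)" using sg by (simp add: walls_at_def)
    moreover have "g \<notin> walls_at P v" using d_tight[of g] sg(3) by auto
    ultimately show False using mx sub by blast
  qed
  then show thesis using that v1 v_le pv by blast
qed

text \<open>
  Inside the horoball only the walls incident with \<open>v\<close> matter: from a point violating another wall,
  the geodesic towards \<open>v\<close> would enter \<open>P\<close> through a face that is not incident with \<open>v\<close>.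
\<close>

lemma horoball_point:
  assumes v: "v \<in> ideal_boundary" "\<forall>g\<in>walls P. lorentz v g \<le> 0"
    and close: "\<forall>e\<in>walls P. face P e \<inter> {x \<in> hyp. lorentz x v \<ge> - c} \<noteq> {} \<longrightarrow> e \<in> walls_at P v"
    and x: "x \<in> hyp" "lorentz x v \<ge> - c" "\<And>g. g \<in> walls_at P v \<Longrightarrow> lorentz x g \<le> 0"
  shows "x \<in> P"
proof (rule ccontr)
  assume "x \<notin> P"
  then obtain h where h: "h \<in> walls P" "lorentz x h > 0" using x(1) by (force simp: P_iff not_le)
  have neg: "lorentz v g < 0" if "g \<in> walls P" "g \<notin> walls_at P v" for g
    using v(2) that by (auto simp: walls_at_def less_le)
  have vc: "norm (snd v) \<le> fst v" "v \<noteq> 0" using v(1) by (auto simp: ideal_boundary_iff)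
  have xf: "x \<in> future" "lorentz x x = - 1" using x(1) by (simp_all add: hyp_future)
  have vv: "lorentz v v = 0" using v(1) by (simp add: ideal_boundary_def)
  have xv: "lorentz x v < 0" by (rule future_lorentz_causal[OF xf(1) vc])
  have h': "lorentz v h < 0" using neg[OF h(1)] x(3)[of h] h(2) by fastforce
  \<comment> \<open>Walls not incident with \<open>v\<close> have negative product with
    \<open>v\<close>, so moving far enough towards \<open>v\<close> satisfies every inequality; this
    \<open>T\<close> suffices for all walls at once.\<close>
  define T where "T = (\<Sum>g\<in>walls P. \<bar>lorentz x g / lorentz v g\<bar>)"
  have start: "lorentz (x + T *\<^sub>R v) g \<le> 0" if g: "g \<in> walls P" for g
  proof (cases "g \<in> walls_at P v")
    case True
    then have "lorentz v g = 0" by (simp add: walls_at_def)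
    then show ?thesis using x(3)[OF True] by simp
  next
    case False
    then have n: "lorentz v g < 0" using neg g by blast
    have "\<bar>lorentz x g / lorentz v g\<bar> \<le> T"
      unfolding T_def using finite_walls g by (intro member_le_sum) auto
    then have "\<bar>lorentz x g / lorentz v g\<bar> * (- lorentz v g) \<le> T * (- lorentz v g)"
      using n by (intro mult_right_mono) auto
    moreover have "\<bar>lorentz x g / lorentz v g\<bar> * (- lorentz v g) = \<bar>lorentz x g\<bar>"
      using n by (simp add: abs_divide)
    ultimately show ?thesis by simp
  qed
  have vh: "lorentz (- v) h > 0" using h' by simp
  obtain s g where g: "g \<in> walls P" "lorentz (- v) g > 0"
    and zg: "lorentz (x + T *\<^sub>R v + s *\<^sub>R - v) g = 0"
    and z_le: "\<forall>g\<in>walls P. lorentz (x + T *\<^sub>R v + s *\<^sub>R - v) g \<le> 0"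
    by (rule ray_exit[OF finite_walls start h(1) vh])
  define t where "t = T - s"
  define z where "z = x + t *\<^sub>R v"
  have z_eq: "x + T *\<^sub>R v + s *\<^sub>R - v = z" by (simp add: z_def t_def algebra_simps)
  have "t * lorentz v h < 0" using bspec[OF z_le h(1)] h(2) unfolding z_eq by (simp add: z_def)
  then have "t > 0" using h' by (simp add: mult_less_0_iff)
  then have "norm (snd (t *\<^sub>R v)) \<le> fst (t *\<^sub>R v)" using vc by simp
  then have zf: "z \<in> future" unfolding z_def by (rule future_add_causal[OF xf(1)])
  then obtain b where b: "b > 0" "b *\<^sub>R z \<in> P"
    by (rule normalize_P) (use z_le z_eq in auto)
  then have b_hyp: "b *\<^sub>R z \<in> hyp" by (simp add: P_iff)
  \<comment> \<open>The self-product of \<open>z\<close> is at most -1, so normalising does not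
    enlarge \<open>z\<close>, and the product with \<open>v\<close> does not fall below that of
    \<open>x\<close>: the face point is still in the horoball.\<close>
  have zz: "lorentz z z = - 1 + 2 * t * lorentz x v"
    using xf by (simp add: z_def vv lorentz_commute[of v x])
  have "t * lorentz x v < 0" using \<open>t > 0\<close> xv by (simp add: mult_pos_neg)
  then have "1 \<le> - lorentz z z" unfolding zz by simp
  moreover have "b\<^sup>2 * (- lorentz z z) = 1"
    using b_hyp by (simp add: hyp_future power2_eq_square)
  ultimately have "b\<^sup>2 \<le> 1" using mult_left_mono[of 1 "- lorentz z z" "b\<^sup>2"] by simp
  then have "b \<le> 1" using b(1) by (simp add: abs_square_le_1)
  have "lorentz (b *\<^sub>R z) v = b * lorentz x v" by (simp add: z_def vv)
  moreover have "b * lorentz x v \<ge> lorentz x v"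
    using \<open>b \<le> 1\<close> xv by (metis less_imp_le mult_1 mult_right_mono_neg)
  ultimately have "lorentz (b *\<^sub>R z) v \<ge> - c" using x(2) by linarith
  moreover have "lorentz (b *\<^sub>R z) g = 0" using zg unfolding z_eq lorentz_linear(7) by simp
  ultimately have "b *\<^sub>R z \<in> face P g \<inter> {x \<in> hyp. lorentz x v \<ge> - c}"
    using b(2) b_hyp by (simp add: face_def hyp_hyperplane_def del: lorentz_linear)
  then have "g \<in> walls_at P v" using close g(1) by blast
  then show False using g(2) by (simp add: walls_at_def)
qed

text \<open>The maximality argument again, now in the horosphere modulo \<open>v\<close>. A
  direction along which no wall at \<open>v\<close> changes is a multiple of \<open>v\<close>, and
  each line parallel to \<open>v\<close> meets the horosphere at most once.\<close>

lemma link_vertex: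
  assumes p: "p \<in> P" and pv: "walls_at P p \<subseteq> walls_at P v"
    and v: "v \<in> ideal_boundary" "\<forall>g\<in>walls P. lorentz v g \<le> 0"
    and vertex: "\<forall>x. (\<forall>e\<in>walls_at P v. lorentz x e = 0) \<longrightarrow> x = fst x *\<^sub>R v"
    and S: "close_horosphere P v S"
  obtains w where "w \<in> link_vertices P S" "w \<in> P" "walls_at P p \<subseteq> walls_at P w"
proof -
  obtain c where c: "c > 0" and S_eq: "S = {x \<in> hyp. lorentz x v = - c}"
    and close: "\<forall>e\<in>walls P. face P e \<inter> {x \<in> hyp. lorentz x v \<ge> - c} \<noteq> {} \<longrightarrow> e \<in> walls_at P v"
    using S unfolding close_horosphere_def by blast
  have vc: "norm (snd v) \<le> fst v" "v \<noteq> 0" using v(1) by (auto simp: ideal_boundary_iff)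
  have vv: "lorentz v v = 0" using v(1) by (simp add: ideal_boundary_def)
  have v_tight: "lorentz v g = 0" if "g \<in> walls_at P v" for g using that by (simp add: walls_at_def)
  \<comment> \<open>Sliding along \<open>v\<close> leaves the products with the walls at
    \<open>v\<close> unchanged, and inside the horoball these walls alone decide membership in
    \<open>P\<close>.\<close>
  have to_S: "\<exists>t. y + t *\<^sub>R v \<in> S \<and> y + t *\<^sub>R v \<in> P"
    if y: "lorentz y v = - c" "\<And>g. g \<in> walls_at P v \<Longrightarrow> lorentz y g \<le> 0" for y
  proof -
    obtain t where t: "y + t *\<^sub>R v \<in> hyp" "lorentz (y + t *\<^sub>R v) v = - c"
      by (rule horosphere_meets_line[OF v(1) c y(1)])
    have "lorentz (y + t *\<^sub>R v) g \<le> 0" if "g \<in> walls_at P v" for g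
      using y(2)[OF that] v_tight[OF that] by simp
    then have "y + t *\<^sub>R v \<in> P" using t by (intro horoball_point[OF v close]) simp_all
    then show ?thesis using t S_eq by blast
  qed
  define Q where "Q x \<longleftrightarrow> x \<in> S \<and> x \<in> P \<and> walls_at P p \<subseteq> walls_at P x" for x
  have "\<exists>x. Q x"
  proof -
    have "lorentz p v < 0" by (rule future_lorentz_causal[OF P_future[OF p] vc])
    \<comment> \<open>The rescaled \<open>p\<close> lies in the slice, and sliding it along
      \<open>v\<close> loses none of its walls, since these pass through \<open>v\<close>.\<close>
    define a where "a = - c / lorentz p v"
    have a: "a > 0" "a * lorentz p v = - c" using c \<open>lorentz p v < 0\<close>
      by (simp_all add: a_def divide_less_0_iff)
    have ap: "lorentz (a *\<^sub>R p) v = - c" using a(2) by simp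
    have "lorentz (a *\<^sub>R p) g \<le> 0" if "g \<in> walls_at P v" for g
      using a(1) p that by (simp add: P_iff walls_at_def mult_le_0_iff)
    from to_S[OF ap this]
    obtain t where t: "a *\<^sub>R p + t *\<^sub>R v \<in> S" "a *\<^sub>R p + t *\<^sub>R v \<in> P" by blast
    have "walls_at P p \<subseteq> walls_at P (a *\<^sub>R p + t *\<^sub>R v)"
    proof
      fix g assume g: "g \<in> walls_at P p"
      then have "lorentz v g = 0" using pv v_tight by blast
      then show "g \<in> walls_at P (a *\<^sub>R p + t *\<^sub>R v)" using g by (simp add: walls_at_def)
    qed
    then show ?thesis using t unfolding Q_def by blast
  qed
  then obtain x where "Q x" ..
  then obtain w where w: "Q w" and mx: "\<And>z. Q z \<Longrightarrow> \<not> walls_at P w \<subset> walls_at P z"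
    by (rule maximal_walls_at) blast
  have wS: "w \<in> S" and wP: "w \<in> P" and pw: "walls_at P p \<subseteq> walls_at P w" using w by (simp_all add: Q_def)
  have wv: "lorentz w v = - c" and w_hyp: "w \<in> hyp" using wS by (simp_all add: S_eq)
  have wv_sub: "walls_at P w \<subseteq> walls_at P v"
  proof
    fix g assume g: "g \<in> walls_at P w"
    then have "w \<in> face P g \<inter> {x \<in> hyp. lorentz x v \<ge> - c}"
      using wP wv w_hyp by (simp add: face_def hyp_hyperplane_def walls_at_def)
    then show "g \<in> walls_at P v" using close g by (auto simp: walls_at_def)
  qed
  have unique: "x = w" if x: "x \<in> S" "\<forall>e\<in>walls_at P w. lorentz x e = 0" for x
  proof (rule ccontr)
    assume "x \<noteq> w"
    define d where "d = x - w"
    have dv: "lorentz d v = 0" using x(1) wv by (simp add: d_def S_eq)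
    have d_tight: "lorentz d e = 0" if "e \<in> walls_at P w" for e
      using x(2) that by (simp add: d_def walls_at_def)
    have "\<exists>g\<in>walls_at P v. lorentz d g \<noteq> 0"
    proof (rule ccontr)
      assume "\<not> ?thesis"
      then have "d = fst d *\<^sub>R v" using vertex by blast
      then obtain b where b: "x = w + b *\<^sub>R v" by (metis d_def diff_add_cancel add.commute)
      have "lorentz x x = - 1" "lorentz w w = - 1" using x(1) w_hyp by (simp_all add: S_eq hyp_future)
      moreover have "lorentz x x = lorentz w w - 2 * b * c"
        unfolding b by (simp add: vv wv lorentz_commute[of v w])
      ultimately have "b = 0" using c by simp
      then show False using b \<open>x \<noteq> w\<close> by simp
    qed
    then obtain g0 where g0: "g0 \<in> walls_at P v" "lorentz d g0 \<noteq> 0" by blast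
    define d' where "d' = (if lorentz d g0 > 0 then d else - d)"
    have d': "lorentz d' g0 > 0" "lorentz d' v = 0" "\<And>e. e \<in> walls_at P w \<Longrightarrow> lorentz d' e = 0"
      using g0 dv d_tight by (auto simp: d'_def)
    have w_le: "lorentz w g \<le> 0" if "g \<in> walls_at P v" for g
      using wP that by (simp add: P_iff walls_at_def)
    obtain s g where sg: "g \<in> walls_at P v" "lorentz d' g > 0" "lorentz (w + s *\<^sub>R d') g = 0"
      "\<forall>g\<in>walls_at P v. lorentz (w + s *\<^sub>R d') g \<le> 0"
      by (rule ray_exit[OF finite_walls_at w_le g0(1) d'(1)])
    have "lorentz (w + s *\<^sub>R d') v = - c" using wv d' by simp
    then obtain t where t: "w + s *\<^sub>R d' + t *\<^sub>R v \<in> S" "w + s *\<^sub>R d' + t *\<^sub>R v \<in> P"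
      using to_S sg(4) by blast
    let ?z = "w + s *\<^sub>R d' + t *\<^sub>R v"
    have sub: "walls_at P w \<subseteq> walls_at P ?z"
      using d'(3) v_tight wv_sub by (auto simp: walls_at_def)
    have "g \<in> walls_at P ?z" using sg v_tight[OF sg(1)] by (simp add: walls_at_def)
    moreover have "g \<notin> walls_at P w" using d'(3)[of g] sg(2) by auto
    moreover have "Q ?z" using t sub pw unfolding Q_def by blast
    ultimately show False using mx sub by blast
  qed
  have "w \<in> link_vertices P S"
    using wS wP unique unfolding link_vertices_def by (auto simp: walls_at_def)
  then show thesis using that wP pw by blast
qed

text \<open>Adding to \<open>v\<close> a vanishing multiple of a point of \<open>P\<close> gives
  points of the cone over \<open>P\<close> whose Klein images converge to \<open>v\<close>.\<close>

lemma vertex_ideal_limit: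
  assumes v: "v \<in> ideal_boundary" "\<forall>g\<in>walls P. lorentz v g \<le> 0"
  shows "v \<in> points_at_infinity P"
proof -
  obtain x where x: "x \<in> P" by (rule interior_point)
  define y where "y n = v + (1 / real (Suc n)) *\<^sub>R x" for n
  have fv: "fst v = 1" "norm (snd v) \<le> fst v" using v(1) by (simp_all add: ideal_boundary_iff)
  have yf: "y n \<in> future" for n
  proof -
    have "(1 / real (Suc n)) *\<^sub>R x + v \<in> future"
      using fv by (intro future_add_causal future_scale P_future[OF x]) simp_all
    then show ?thesis by (simp add: y_def add.commute)
  qed
  have in_klein: "klein (y n) \<in> klein ` P" for n
  proof -
    have "lorentz (y n) g \<le> 0" if "g \<in> walls P" for g
    proof -
      have "lorentz v g \<le> 0" "lorentz x g \<le> 0" using v(2) x that by (simp_all add: P_iff)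
      then have "lorentz v g + 1 / real (Suc n) * lorentz x g \<le> 0"
        by (intro add_nonpos_nonpos mult_nonneg_nonpos) simp_all
      then show ?thesis by (simp add: y_def)
    qed
    then obtain c where "c > 0" "c *\<^sub>R y n \<in> P" using normalize_P[OF yf] by metis
    then show ?thesis using klein_scale[of c "y n"] by (metis image_eqI less_irrefl)
  qed
  have "(\<lambda>n. 1 / real (Suc n)) \<longlonglongrightarrow> 0" using LIMSEQ_inverse_real_of_nat by (simp add: inverse_eq_divide)
  then have "y \<longlonglongrightarrow> v + 0 *\<^sub>R x" unfolding y_def by (intro tendsto_intros)
  then have lim: "y \<longlonglongrightarrow> v" by simp
  have "(\<lambda>n. inverse (fst (y n)) *\<^sub>R y n) \<longlonglongrightarrow> inverse (fst v) *\<^sub>R v"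
    by (intro tendsto_intros lim) (simp add: fv)
  then have "(\<lambda>n. klein (y n)) \<longlonglongrightarrow> v" by (simp add: klein_def fv)
  then have "v \<in> closure (klein ` P)" using in_klein by (intro closure_klein)
  then show ?thesis using v(1) by (simp add: points_at_infinity_def)
qed

text \<open>The direction \<open>v\<close> is causal by finite volume. If timelike, it normalises to
  a finite vertex; if null, it is an ideal vertex whose link supplies \<open>w\<close>. In either
  case the ray meets hyperboloid and boundary together in one point, the uniqueness required of a
  vertex.\<close>

lemma ex_vertex:
  assumes p: "p \<in> P" and S: "\<forall>v\<in>ideal_vertices P. close_horosphere P v (S v)"
  obtains (finite_vertex) v where "v \<in> finite_vertices P" "walls_at P p \<subseteq> walls_at P v"
  | (ideal_vertex) v w where "v \<in> ideal_vertices P" "w \<in> link_vertices P (S v)"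
    "walls_at P p \<subseteq> walls_at P v" "walls_at P p \<subseteq> walls_at P w"
proof -
  obtain v where v1: "fst v = 1" and v_le: "\<forall>g\<in>walls P. lorentz v g \<le> 0"
    and pv: "walls_at P p \<subseteq> walls_at P v"
    and vertex: "\<forall>x. (\<forall>e\<in>walls_at P v. lorentz x e = 0) \<longrightarrow> x = fst x *\<^sub>R v"
    by (rule vertex_direction[OF p])
  have vc: "norm (snd v) \<le> fst v" using v_le by (intro causal) blast
  show thesis
  proof (cases "norm (snd v) < 1")
    case True
    then have vf: "v \<in> future" using v1 by (simp add: future_def)
    then obtain c where c: "c > 0" "c *\<^sub>R v \<in> P" by (rule normalize_P) (use v_le in blast)
    have at: "walls_at P (c *\<^sub>R v) = walls_at P v" using c by (auto simp: walls_at_def)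
    have c_hyp: "c *\<^sub>R v \<in> hyp" using c(2) by (simp add: P_iff)
    have lv: "lorentz v v < 0" using vf by (simp add: future_iff)
    have "x = c *\<^sub>R v" if x: "x \<in> hyp \<union> ideal_boundary" "\<forall>e\<in>walls_at P v. lorentz x e = 0" for x
    proof -
      have xv: "x = fst x *\<^sub>R v" using vertex x(2) by blast
      then have xx: "lorentz x x = (fst x)\<^sup>2 * lorentz v v"
        by (metis lorentz_linear(7,8) mult.assoc power2_eq_square)
      have fx: "fst x > 0" using x(1) by (auto simp: hyp_def ideal_boundary_def)
      then have "lorentz x x < 0" unfolding xx using lv by (simp add: mult_pos_neg)
      then have "lorentz x x = - 1" using x(1) by (auto simp: hyp_def ideal_boundary_def)
      moreover have "c\<^sup>2 * lorentz v v = - 1" using c_hyp by (simp add: hyp_future power2_eq_square)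
      ultimately have "(fst x)\<^sup>2 = c\<^sup>2" using lv xx by (metis less_irrefl mult_right_cancel)
      then have "fst x = c" using fx c(1) by (simp add: power2_eq_iff_nonneg)
      then show ?thesis using xv by simp
    qed
    moreover have "\<forall>e\<in>walls_at P v. lorentz (c *\<^sub>R v) e = 0" by (simp add: walls_at_def)
    ultimately have "c *\<^sub>R v \<in> finite_vertices P"
      using c(2) c_hyp by (auto simp: finite_vertices_def vertices_def at)
    then show thesis using finite_vertex pv at by blast
  next
    case False
    then have vi: "v \<in> ideal_boundary" using vc v1 by (simp add: ideal_boundary_iff)
    have vv: "lorentz v v = 0" using vi by (simp add: ideal_boundary_def)
    have "x = v" if x: "x \<in> hyp \<union> ideal_boundary" "\<forall>e\<in>walls_at P v. lorentz x e = 0" for x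
    proof -
      have xv: "x = fst x *\<^sub>R v" using vertex x(2) by blast
      then have "lorentz x x = 0" by (metis lorentz_linear(7,8) mult_zero_right vv)
      then have "fst x = 1" using x(1) by (auto simp: hyp_def ideal_boundary_def)
      then show ?thesis using xv by simp
    qed
    moreover have "\<forall>e\<in>walls_at P v. lorentz v e = 0" by (simp add: walls_at_def)
    ultimately have iv: "v \<in> ideal_vertices P"
      using vi vertex_ideal_limit[OF vi v_le] by (auto simp: ideal_vertices_def vertices_def)
    obtain w where "w \<in> link_vertices P (S v)" "walls_at P p \<subseteq> walls_at P w"
      by (rule link_vertex[OF p pv vi v_le vertex bspec[OF S iv]])
    then show thesis using ideal_vertex iv pv by blast
  qed
qed

end

subsection \<open>Torsion\<close>

lemma pow_funpow:
  fixes H :: "('a \<Rightarrow> 'a, 'b) monoid_scheme"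
  assumes "monoid.mult H = (\<circ>)" "one H = id"
  shows "f [^]\<^bsub>H\<^esub> (m::nat) = f ^^ m"
proof (induction m)
  case 0
  show ?case by (simp add: nat_pow_def assms id_def)
next
  case (Suc m)
  have "f [^]\<^bsub>H\<^esub> Suc m = f [^]\<^bsub>H\<^esub> m \<circ> f" by (simp add: nat_pow_def assms)
  then show ?case using Suc by (simp add: funpow_Suc_right del: funpow.simps)
qed

text \<open>The sum over an orbit of a finite cyclic group is a fixed vector in the future cone.\<close>

lemma torsion_fixed_point:
  fixes f :: "'n::finite mink \<Rightarrow> 'n mink" and x :: "'n mink"
  assumes lin: "linear f" and hyp: "\<And>x. x \<in> hyp \<Longrightarrow> f x \<in> hyp"
    and m: "m > 0" "f ^^ m = id" and x: "x \<in> hyp"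
  obtains y where "y \<in> hyp" "f y = y"
proof -
  define z where "z = (\<Sum>k<m. (f ^^ k) x)"
  have pow_hyp: "(f ^^ k) x \<in> hyp" for k by (induction k) (simp_all add: x hyp)
  have sums: "(\<Sum>k<Suc n. (f ^^ k) x) \<in> future" for n
  proof (induction n)
    case 0
    then show ?case using x by (simp add: hyp_future)
  next
    case (Suc n)
    have "(\<Sum>k<Suc (Suc n). (f ^^ k) x) = (\<Sum>k<Suc n. (f ^^ k) x) + (f ^^ Suc n) x"
      by (rule sum.lessThan_Suc)
    then show ?case using Suc pow_hyp[of "Suc n"] by (simp only: future_add hyp_future)
  qed
  have "z \<in> future" unfolding z_def using sums[of "m - 1"] m(1) by (simp del: sum.lessThan_Suc)
  then obtain c where c: "c > 0" "c *\<^sub>R z \<in> hyp" by (rule future_normalize)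
  have "f z = (\<Sum>k<m. (f ^^ Suc k) x)" by (simp add: z_def linear_sum[OF lin])
  moreover have "(\<Sum>k<Suc m. (f ^^ k) x) = x + (\<Sum>k<m. (f ^^ Suc k) x)"
    by (simp only: sum.lessThan_Suc_shift funpow_0)
  moreover have "(\<Sum>k<Suc m. (f ^^ k) x) = z + x" using m(2) by (simp add: z_def)
  ultimately have "f z = z" by simp
  then have "f (c *\<^sub>R z) = c *\<^sub>R z" by (simp add: linear_scale[OF lin])
  then show thesis using that c(2) by blast
qed

lemma finite_order:
  assumes fin: "finite F" and closed: "\<And>k. f ^^ k \<in> F" and inj: "inj f"
  obtains m where "m > 0" "f ^^ m = id"
proof -
  have "\<not> inj (\<lambda>k. f ^^ k)"
    using finite_subset[OF _ fin, of "range (\<lambda>k. f ^^ k)"] closed finite_imageD[of "\<lambda>k. f ^^ k" UNIV]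
    by auto
  then obtain i j where ij: "i < j" "f ^^ i = f ^^ j"
    unfolding inj_def by (metis nat_neq_iff)
  have "(f ^^ i) ((f ^^ (j - i)) x) = (f ^^ i) x" for x
    using ij by (metis add_diff_inverse_nat comp_apply funpow_add less_asym)
  moreover have "inj (f ^^ i)" using inj by (rule inj_fn)
  ultimately have "f ^^ (j - i) = id" by (auto simp: inj_def)
  then show thesis using that[of "j - i"] ij(1) by simp
qed

context coxeter
begin

lemma coxeter_group_simps:
  "carrier (coxeter_group P) = W"
  "f \<otimes>\<^bsub>coxeter_group P\<^esub> g = f \<circ> g"
  "\<one>\<^bsub>coxeter_group P\<^esub> = id"
  using generate_reflections[of "walls P"] wall_unit
  by (simp_all add: coxeter_group_def hyp_isom_def)

lemma group_coxeter_group: "group (coxeter_group P)"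
proof -
  interpret group "hyp_isom :: ('n mink \<Rightarrow> 'n mink) monoid" by (rule group_hyp_isom)
  have "hyp_reflection ` walls P \<subseteq> carrier hyp_isom"
  proof
    fix r assume "r \<in> hyp_reflection ` walls P"
    then obtain e where "e \<in> walls P" "r = word [e]" by auto
    then show "r \<in> carrier hyp_isom" using word_isom[of "[e]"] wall_unit by simp
  qed
  then have "subgroup (generate hyp_isom (hyp_reflection ` walls P)) hyp_isom"
    by (rule generate_is_subgroup)
  then show ?thesis unfolding coxeter_group_def
    by (rule subgroup.subgroup_is_group) (rule group_hyp_isom)
qed

lemma torsion_free_kernel_iff:
  "torsion_free ((coxeter_group P)\<lparr>carrier := kernel (coxeter_group P) G \<phi>\<rparr>) \<longleftrightarrow>
    (\<forall>f\<in>W. \<forall>m>0. \<phi> f = \<one>\<^bsub>G\<^esub> \<longrightarrow> f ^^ m = id \<longrightarrow> f = id)"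
proof -
  let ?H = "(coxeter_group P)\<lparr>carrier := kernel (coxeter_group P) G \<phi>\<rparr>"
  have mult: "monoid.mult ?H = (\<circ>)" and one: "one ?H = id"
    by (simp_all add: coxeter_group_def hyp_isom_def)
  have "carrier ?H = {f \<in> W. \<phi> f = \<one>\<^bsub>G\<^esub>}"
    by (simp add: kernel_def coxeter_group_simps)
  then show ?thesis
    unfolding torsion_free_def pow_funpow[OF mult one] one by blast
qed

lemma funpow_W: "f \<in> W \<Longrightarrow> f ^^ k \<in> W"
proof (induction k)
  case 0
  then show ?case using id_W by (simp add: id_def)
next
  case (Suc k)
  then show ?case unfolding funpow.simps by (intro W_comp)
qed

lemma W_inj: "f \<in> W \<Longrightarrow> inj f"
  by (erule W_inverse) (metis injI)

lemma finite_order_stabilizer: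
  assumes f: "f \<in> W" and w: "w \<in> hyp" "f w = w"
  obtains m where "m > 0" "f ^^ m = id"
proof (rule finite_order[OF finite_stabilizer[OF w(1)] _ W_inj[OF f]])
  have "(f ^^ k) w = w" for k by (induction k) (simp_all add: w)
  then show "f ^^ k \<in> {\<gamma> \<in> W. \<gamma> w = w}" for k using funpow_W[OF f] by simp
qed

text \<open>The quotient of two elements with equal image is in the kernel and in a finite
  stabiliser, so it has finite order. Stated for any point of the hyperboloid, this serves finite
  vertices and link vertices alike.\<close>

lemma torsion_free_imp_inj_on:
  assumes "group G" and hom: "\<phi> \<in> hom (coxeter_group P) G"
    and tf: "torsion_free ((coxeter_group P)\<lparr>carrier := kernel (coxeter_group P) G \<phi>\<rparr>)"
    and w: "w \<in> hyp"
  shows "inj_on \<phi> {\<gamma> \<in> W. \<gamma> w = w}"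
proof (rule inj_onI)
  interpret group_hom "coxeter_group P" G \<phi>
    using assms(1) hom group_coxeter_group by (simp add: group_hom_def group_hom_axioms_def)
  fix f g assume fg: "f \<in> {\<gamma> \<in> W. \<gamma> w = w}" "g \<in> {\<gamma> \<in> W. \<gamma> w = w}" "\<phi> f = \<phi> g"
  have W: "f \<in> W" "g \<in> W" and fixes_w: "f w = w" "g w = w" using fg by simp_all
  obtain f' where f': "f' \<in> W" "\<And>x. f' (f x) = x" "\<And>x. f (f' x) = x"
    by (rule W_inverse[OF W(1)]) blast
  have "\<phi> (f' \<circ> g) = \<phi> f' \<otimes>\<^bsub>G\<^esub> \<phi> g"
    using hom_mult[of f' g] f'(1) W(2) by (simp only: coxeter_group_simps)
  also have "\<dots> = \<phi> f' \<otimes>\<^bsub>G\<^esub> \<phi> f" using fg(3) by simp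
  also have "\<dots> = \<phi> (f' \<circ> f)"
    using hom_mult[of f' f] f'(1) W(1) by (simp only: coxeter_group_simps)
  also have "f' \<circ> f = id" using f'(2) by (simp add: fun_eq_iff)
  finally have ker: "\<phi> (f' \<circ> g) = \<one>\<^bsub>G\<^esub>" using hom_one by (simp only: coxeter_group_simps)
  have comp: "f' \<circ> g \<in> W" using f'(1) W(2) by (rule W_comp)
  have "(f' \<circ> g) w = w" using f'(2)[of w] fixes_w by simp
  then obtain m where "m > 0" "(f' \<circ> g) ^^ m = id"
    by (rule finite_order_stabilizer[OF comp w])
  then have "f' \<circ> g = id" using tf comp ker unfolding torsion_free_kernel_iff by blast
  then have "f' (g x) = x" for x by (simp add: fun_eq_iff)
  then show "f = g" using f'(3) by (metis ext)
qed

lemma finite_vertex_stabilizer_eq: "finite_vertex_stabilizer P v = {\<gamma> \<in> W. \<gamma> v = v}"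
  by (simp add: finite_vertex_stabilizer_def stabilizer_def coxeter_group_simps)

lemma link_vertex_stabilizer_eq:
  "link_vertex_stabilizer P v w = {\<gamma> \<in> W. klein (\<gamma> v) = v \<and> \<gamma> w = w}"
  by (auto simp: link_vertex_stabilizer_def ideal_vertex_stabilizer_def stabilizer_def
      coxeter_group_simps ideal_action_def)

end

context finite_volume_coxeter
begin

lemma inj_on_imp_torsion_free:
  assumes "group G" and hom: "\<phi> \<in> hom (coxeter_group P) G"
    and S: "\<And>v. v \<in> ideal_vertices P \<Longrightarrow> close_horosphere P v (S v)"
    and fin: "\<And>v. v \<in> finite_vertices P \<Longrightarrow> inj_on \<phi> (finite_vertex_stabilizer P v)"
    and ideal: "\<And>v w. v \<in> ideal_vertices P \<Longrightarrow> w \<in> link_vertices P (S v) \<Longrightarrow>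
      inj_on \<phi> (link_vertex_stabilizer P v w)"
  shows "torsion_free ((coxeter_group P)\<lparr>carrier := kernel (coxeter_group P) G \<phi>\<rparr>)"
  unfolding torsion_free_kernel_iff
proof (intro ballI allI impI)
  interpret group_hom "coxeter_group P" G \<phi>
    using assms(1) hom group_coxeter_group by (simp add: group_hom_def group_hom_axioms_def)
  have hom_comp: "\<phi> (a \<circ> b) = \<phi> a \<otimes>\<^bsub>G\<^esub> \<phi> b" if "a \<in> W" "b \<in> W" for a b
    using hom_mult[of a b] that by (simp only: coxeter_group_simps)
  have hom_id: "\<phi> id = \<one>\<^bsub>G\<^esub>" using hom_one by (simp only: coxeter_group_simps)
  fix f m assume f: "f \<in> W" and m: "0 < m" and ker: "\<phi> f = \<one>\<^bsub>G\<^esub>" and fm: "f ^^ m = id"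
  obtain x where "x \<in> P" by (rule interior_point)
  then have x: "x \<in> hyp" by (simp add: P_iff)
  obtain y where y: "y \<in> hyp" "f y = y"
    by (rule torsion_fixed_point[OF W_linear[OF f] W_hyp[OF f] m fm x])
  obtain \<gamma> where \<gamma>: "\<gamma> \<in> W" "\<gamma> y \<in> P" by (rule W_covers[OF y(1)])
  obtain \<gamma>' where \<gamma>': "\<gamma>' \<in> W" "\<And>x. \<gamma>' (\<gamma> x) = x" "\<And>x. \<gamma> (\<gamma>' x) = x"
    by (rule W_inverse[OF \<gamma>(1)]) blast
  define p where "p = \<gamma> y"
  define h where "h = \<gamma> \<circ> (f \<circ> \<gamma>')"
  have f\<gamma>: "f \<circ> \<gamma>' \<in> W" by (rule W_comp[OF f \<gamma>'(1)])
  have h: "h \<in> W" unfolding h_def by (rule W_comp[OF \<gamma>(1) f\<gamma>])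
  have p: "p \<in> P" "h p = p" using \<gamma> \<gamma>'(2) y(2) by (simp_all add: p_def h_def)
  have "\<phi> h = \<phi> \<gamma> \<otimes>\<^bsub>G\<^esub> (\<phi> f \<otimes>\<^bsub>G\<^esub> \<phi> \<gamma>')"
    unfolding h_def hom_comp[OF \<gamma>(1) f\<gamma>] hom_comp[OF f \<gamma>'(1)] ..
  also have "\<dots> = \<phi> \<gamma> \<otimes>\<^bsub>G\<^esub> \<phi> \<gamma>'"
    using hom_closed[of \<gamma>'] \<gamma>'(1) ker by (simp add: coxeter_group_simps)
  also have "\<dots> = \<phi> (\<gamma> \<circ> \<gamma>')" using hom_comp[OF \<gamma>(1) \<gamma>'(1)] by simp
  also have "\<gamma> \<circ> \<gamma>' = id" using \<gamma>'(3) by (simp add: fun_eq_iff)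
  finally have h_ker: "\<phi> h = \<phi> id" .
  \<comment> \<open>For an ideal \<open>v\<close> the null vector itself is fixed, not only its ray,
    so \<open>h\<close> stabilises \<open>v\<close> under the ideal action too.\<close>
  have h_fix: "h v = v" if "walls_at P p \<subseteq> walls_at P v" for v
  proof (rule W_stabilizer[OF h p(1)])
    show "h p \<in> P" using p by simp
    show "lorentz v e = 0" if "e \<in> walls_at P p" for e
      using that \<open>walls_at P p \<subseteq> walls_at P v\<close> by (auto simp: walls_at_def)
  qed
  have "\<forall>v\<in>ideal_vertices P. close_horosphere P v (S v)" using S by blast
  with p(1) have "h = id"
  proof (cases rule: ex_vertex)
    case (finite_vertex v)
    have "h \<in> finite_vertex_stabilizer P v" "id \<in> finite_vertex_stabilizer P v"
      using h h_fix[OF finite_vertex(2)] id_W by (simp_all add: finite_vertex_stabilizer_eq)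
    then show ?thesis using fin[OF finite_vertex(1)] h_ker by (meson inj_onD)
  next
    case (ideal_vertex v w)
    have "klein v = v" using ideal_vertex(1) by (simp add: ideal_vertices_def ideal_boundary_def klein_def)
    then have "h \<in> link_vertex_stabilizer P v w" "id \<in> link_vertex_stabilizer P v w"
      using h h_fix[OF ideal_vertex(3)] h_fix[OF ideal_vertex(4)] id_W by (simp_all add: link_vertex_stabilizer_eq)
    then show ?thesis using ideal[OF ideal_vertex(1,2)] h_ker by (meson inj_onD)
  qed
  then have "\<gamma> (f (\<gamma>' x)) = x" for x by (simp add: h_def fun_eq_iff)
  then have "f x = x" for x using \<gamma>'(2) by metis
  then show "f = id" by (simp add: fun_eq_iff)
qed

end

text \<open>Finiteness matters because \<open>card\<close> is 0 on infinite sets, where equal values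
  would not amount to injectivity.\<close>

lemma card_image_eq_iff_inj_on:
  "finite F \<Longrightarrow> card F = card (\<phi> ` F) \<longleftrightarrow> inj_on \<phi> F"
  using card_image eq_card_imp_inj_on by metis

theorem proposition1:
  fixes P :: "'n::finite mink set"
    and G :: "('g, 'b) monoid_scheme"
    and \<phi> :: "('n mink \<Rightarrow> 'n mink) \<Rightarrow> 'g"
    and \<Sigma> :: "'n mink \<Rightarrow> 'n mink set"
  assumes "coxeter_polyhedron P"
    and "hyp_volume P < \<infinity>"
    and "group G"
    and "\<phi> \<in> hom (coxeter_group P) G"
    and "\<And>v. v \<in> ideal_vertices P \<Longrightarrow> close_horosphere P v (\<Sigma> v)"
  shows "torsion_free ((coxeter_group P)\<lparr>carrier := kernel (coxeter_group P) G \<phi>\<rparr>) \<longleftrightarrow>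
    (\<forall>v\<in>finite_vertices P.
       card (finite_vertex_stabilizer P v) = card (\<phi> ` finite_vertex_stabilizer P v)) \<and>
    (\<forall>v\<in>ideal_vertices P. \<forall>w\<in>link_vertices P (\<Sigma> v).
       card (link_vertex_stabilizer P v w) = card (\<phi> ` link_vertex_stabilizer P v w))"
proof -
  interpret finite_volume_coxeter P
    using assms(1,2) by unfold_locales
  \<comment> \<open>The group of a link vertex lies in the stabiliser of a point of the hyperboloid.
    This makes it finite, and injectivity on the larger stabiliser restricts to it.\<close>
  have sub: "link_vertex_stabilizer P v w \<subseteq> {\<gamma> \<in> W. \<gamma> w = w}" for v w
    by (simp add: link_vertex_stabilizer_eq Collect_mono)
  have w_hyp: "w \<in> hyp" if "w \<in> link_vertices P S" for w S
    using that by (simp add: link_vertices_def P_iff)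
  have fin: "card (finite_vertex_stabilizer P v) = card (\<phi> ` finite_vertex_stabilizer P v) \<longleftrightarrow>
      inj_on \<phi> (finite_vertex_stabilizer P v)" if "v \<in> finite_vertices P" for v
    using that finite_stabilizer[of v] unfolding finite_vertex_stabilizer_eq
    by (intro card_image_eq_iff_inj_on) (simp add: finite_vertices_def)
  have ideal: "card (link_vertex_stabilizer P v w) = card (\<phi> ` link_vertex_stabilizer P v w) \<longleftrightarrow>
      inj_on \<phi> (link_vertex_stabilizer P v w)" if "w \<in> link_vertices P S" for v w S
    using finite_subset[OF sub finite_stabilizer[OF w_hyp[OF that]]]
    by (intro card_image_eq_iff_inj_on)
  show ?thesis (is "?tf \<longleftrightarrow> ?fin \<and> ?ideal")
  proof (intro iffI conjI ballI)
    assume ?tf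
    note inj = torsion_free_imp_inj_on[OF assms(3,4) \<open>?tf\<close>]
    show "card (finite_vertex_stabilizer P v) = card (\<phi> ` finite_vertex_stabilizer P v)"
      if v: "v \<in> finite_vertices P" for v
    proof -
      have "inj_on \<phi> (finite_vertex_stabilizer P v)"
        using inj[of v] v by (simp add: finite_vertices_def finite_vertex_stabilizer_eq)
      then show ?thesis using fin[OF v] by simp
    qed
    show "card (link_vertex_stabilizer P v w) = card (\<phi> ` link_vertex_stabilizer P v w)"
      if w: "w \<in> link_vertices P (\<Sigma> v)" for v w
      unfolding ideal[OF w] by (rule inj_on_subset[OF inj[OF w_hyp[OF w]] sub])
  next
    assume R: "?fin \<and> ?ideal"
    show ?tf
    proof (rule inj_on_imp_torsion_free[OF assms(3,4,5)])
      show "inj_on \<phi> (finite_vertex_stabilizer P v)" if "v \<in> finite_vertices P" for v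
        using R fin[OF that] that by blast
      show "inj_on \<phi> (link_vertex_stabilizer P v w)"
        if "v \<in> ideal_vertices P" "w \<in> link_vertices P (\<Sigma> v)" for v w
        using R ideal[OF that(2)] that by blast
    qed
  qed
qed

end
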